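(* For $n\ge 2$ and $k\ge 0$, the number of shallow $132$-avoiding permutations in $S_n$ with exactly $k$ descents equals $\binom{2n-2-k}{k}$.
   Context: For $\pi\in S_n$: $D(\pi)=\sum_{i}|\pi_i-i|$, $I(\pi)$ is the number of inversions, $T(\pi)=n-\mathrm{cyc}(\pi)$ with $\mathrm{cyc}$ the number of cycles in the disjoint cycle decomposition; $\pi$ is shallow if $I(\pi)+T(\pi)=D(\pi)$. A permutation avoids a pattern $\sigma$ if it has no subsequence order-isomorphic to $\sigma$. A descent of $\pi$ is an index $i\in[n-1]$ with $\pi_i>\pi_{i+1}$. *)

theory Defs
  imports "HOL-Combinatorics.Combinatorics"
begin

text \<open>Permutations of [n] are functions p with p permutes {1..n} (identity outside).\<close>

definition displacement :: "nat \<Rightarrow> (nat \<Rightarrow> nat) \<Rightarrow> int" where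
  "displacement n p = (\<Sum>i\<in>{1..n}. \<bar>int (p i) - int i\<bar>)"

definition inversions :: "nat \<Rightarrow> (nat \<Rightarrow> nat) \<Rightarrow> nat" where
  "inversions n p = card {(i, j). i \<in> {1..n} \<and> j \<in> {1..n} \<and> i < j \<and> p i > p j}"

definition num_cycles :: "nat \<Rightarrow> (nat \<Rightarrow> nat) \<Rightarrow> nat" where
  "num_cycles n p = card ((\<lambda>i. {(p ^^ m) i | m. True}) ` {1..n})"

definition transp_dist :: "nat \<Rightarrow> (nat \<Rightarrow> nat) \<Rightarrow> nat" where
  "transp_dist n p = n - num_cycles n p"

definition shallow :: "nat \<Rightarrow> (nat \<Rightarrow> nat) \<Rightarrow> bool" where
  "shallow n p \<longleftrightarrow> int (inversions n p) + int (transp_dist n p) = displacement n p"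

definition avoids132 :: "nat \<Rightarrow> (nat \<Rightarrow> nat) \<Rightarrow> bool" where
  "avoids132 n p \<longleftrightarrow> \<not> (\<exists>i j k. 1 \<le> i \<and> i < j \<and> j < k \<and> k \<le> n \<and> p i < p k \<and> p k < p j)"

definition descents :: "nat \<Rightarrow> (nat \<Rightarrow> nat) \<Rightarrow> nat set" where
  "descents n p = {i. 1 \<le> i \<and> i \<le> n - 1 \<and> p i > p (Suc i)}"

end

theory Submission
  imports Defs "HOL-Computational_Algebra.Polynomial"
begin

text \<open>Let \<open>D - I - T\<close> be the defect of a permutation. Multiplying by the transposition that
  puts the maximum \<open>u\<close> (or the minimum) in its place changes the defect by an explicit nonnegative
  amount (Diaconis and Graham; Hadjicostas and Monico), so shallowness can be tested one step at a
  time. For a 132-avoiding permutation this forces the maximum to be last or first, or the minimum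
  to be last. The permutations ending with the minimum have one of the forms \<open>n R 1\<close>, \<open>L n 1\<close>,
  \<open>(n-1) L n R 1\<close>, and reduce to \<open>R\<close>, \<open>L 1\<close> and \<open>L m R\<close> respectively; inversion, which preserves
  the number of descents because descents of 132-avoiders correspond to left-to-right minima,
  exchanges them with those starting with the maximum. Working on
  arbitrary intervals \<open>{l..u}\<close> avoids all relabelling of positions and values. With weight
  \<open>x^des\<close>, the resulting recurrences are solved by the Fibonacci polynomials
  \<open>F (m+2) = F (m+1) + x F m\<close>.\<close>

subsection \<open>Orbits, inversions and the defect\<close>

definition orbit_of :: "('a \<Rightarrow> 'a) \<Rightarrow> 'a \<Rightarrow> 'a set" where
  "orbit_of p i = {(p ^^ m) i | m. True}"

definition inversion_set :: "nat set \<Rightarrow> (nat \<Rightarrow> nat) \<Rightarrow> (nat \<times> nat) set" where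
  "inversion_set S p = {(i, j). i \<in> S \<and> j \<in> S \<and> i < j \<and> p i > p j}"

text \<open>Stated for an index set, with cycles counted as distinct forward orbits; all
  subtractions are in \<open>int\<close>, so nothing truncates.\<close>

definition defect :: "nat set \<Rightarrow> (nat \<Rightarrow> nat) \<Rightarrow> int" where
  "defect S p = (\<Sum>i\<in>S. \<bar>int (p i) - int i\<bar>) - int (card (inversion_set S p))
     - (int (card S) - int (card (orbit_of p ` S)))"

lemma orbit_of_self: "i \<in> orbit_of p i"
  unfolding orbit_of_def by (rule CollectI, rule exI[of _ 0]) simp

lemma orbit_of_step: "j \<in> orbit_of p i \<Longrightarrow> p j \<in> orbit_of p i"
  unfolding orbit_of_def by clarsimp (metis funpow.simps(2) o_apply)

text \<open>Reduces orbit inclusions to closure checks: iterates of \<open>i\<close> cannot leave a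
  set closed under \<open>p\<close>.\<close>

lemma orbit_of_least:
  assumes "i \<in> C" "\<And>j. j \<in> C \<Longrightarrow> p j \<in> C"
  shows "orbit_of p i \<subseteq> C"
proof -
  have "(p ^^ m) i \<in> C" for m by (induction m) (use assms in auto)
  then show ?thesis by (auto simp: orbit_of_def)
qed

lemma orbit_of_fixed: "p x = x \<Longrightarrow> orbit_of p x = {x}"
  using orbit_of_least[of x "{x}" p] orbit_of_self[of x p] by auto

lemma orbit_of_eq:
  assumes "p permutes S" "finite S" "j \<in> orbit_of p i"
  shows "orbit_of p j = orbit_of p i"
proof -
  have perm: "permutation p" using assms permutation_permutes by blast
  have sub: "orbit_of p j \<subseteq> orbit_of p i"
    by (rule orbit_of_least[OF assms(3)]) (rule orbit_of_step)
  obtain m where m: "j = (p ^^ m) i" using assms(3) by (auto simp: orbit_of_def)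
  obtain n where n: "(p ^^ n) = id" "n > 0"
    using permutation_is_nilpotent[OF perm] by blast
  \<comment> \<open>As \<open>p ^^ n\<close> is the identity, \<open>n * m - m\<close> further steps
    lead from \<open>(p ^^ m) i\<close> back to \<open>i\<close>.\<close>
  have "(p ^^ (n * m - m)) j = (p ^^ (n * m - m + m)) i"
    unfolding m by (simp add: funpow_add)
  also have "n * m - m + m = n * m" using n(2) by (cases n) auto
  also have "(p ^^ (n * m)) i = i" using n(1) by (simp flip: funpow_mult)
  finally have "i \<in> orbit_of p j" unfolding orbit_of_def by (metis (mono_tags, lifting) CollectI)
  then have "orbit_of p i \<subseteq> orbit_of p j"
    by (rule orbit_of_least) (rule orbit_of_step)
  with sub show ?thesis by simp
qed

text \<open>One step of \<open>p\<close> from \<open>inv p j\<close> reaches \<open>j\<close>, so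
  both lie in one orbit of \<open>p\<close>. Hence orbits of \<open>p\<close> are closed under
  \<open>inv p\<close>, and exchanging the two maps gives the other inclusion.\<close>

lemma orbit_of_inv:
  assumes "p permutes S" "finite S"
  shows "orbit_of (inv p) i = orbit_of p i"
proof -
  have *: "orbit_of (inv p) i \<subseteq> orbit_of p i" if "p permutes S" for p i
  proof (rule orbit_of_least[OF orbit_of_self])
    fix j assume j: "j \<in> orbit_of p i"
    have "p (inv p j) \<in> orbit_of p (inv p j)" by (rule orbit_of_step[OF orbit_of_self])
    then have "j \<in> orbit_of p (inv p j)" by (simp add: permutes_inverses[OF that])
    then have "orbit_of p j = orbit_of p (inv p j)" by (rule orbit_of_eq[OF that assms(2)])
    moreover have "orbit_of p j = orbit_of p i" by (rule orbit_of_eq[OF that assms(2) j])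
    ultimately show "inv p j \<in> orbit_of p i" using orbit_of_self[of "inv p j" p] by simp
  qed
  show ?thesis
    using *[OF assms(1), of i] *[OF permutes_inv[OF assms(1)], of i]
      permutes_inv_inv[OF assms(1)] by auto
qed

text \<open>Composing with the transposition splices the fixed point \<open>x\<close> into the cycle
  of \<open>y\<close>: now \<open>p y = x\<close> and \<open>p x = q y\<close>. The singleton cycle
  of \<open>x\<close> disappears, and the other cycles survive, one of them enlarged by
  \<open>x\<close>.\<close>

lemma card_orbits_transpose:
  assumes q: "q permutes S" and S: "finite S" and xy: "x \<in> S" "y \<in> S" "x \<noteq> y" and qx: "q x = x"
    and p: "p = q \<circ> transpose x y"
  shows "card (orbit_of q ` S) = Suc (card (orbit_of p ` S))"
proof -
  define \<phi> where "\<phi> C = (if y \<in> C then insert x C else C)" for C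
  have px: "p x = q y" and py: "p y = x" and pz: "z \<noteq> x \<Longrightarrow> z \<noteq> y \<Longrightarrow> p z = q z" for z
    using qx by (auto simp: p transpose_def)
  have inj: "q a = q b \<longleftrightarrow> a = b" for a b using permutes_inj[OF q] by (rule inj_eq)
  have nx: "x \<notin> orbit_of q i" if "i \<noteq> x" for i
  proof -
    have "orbit_of q i \<subseteq> - {x}"
      by (rule orbit_of_least) (use that inj[of _ x] qx in auto)
    then show ?thesis by auto
  qed
  have eq: "orbit_of p i = \<phi> (orbit_of q i)" if "i \<noteq> x" for i
  proof
    show "orbit_of p i \<subseteq> \<phi> (orbit_of q i)"
    proof (rule orbit_of_least)
      show "i \<in> \<phi> (orbit_of q i)" using orbit_of_self[of i q] by (auto simp: \<phi>_def)
      fix j assume j: "j \<in> \<phi> (orbit_of q i)"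
      consider "j = x" | "j = y" | "j \<noteq> x" "j \<noteq> y" by blast
      then show "p j \<in> \<phi> (orbit_of q i)"
      proof cases
        case 1
        then have "y \<in> orbit_of q i" using j nx[OF that] by (auto simp: \<phi>_def split: if_splits)
        then show ?thesis using 1 px orbit_of_step[of y q i] by (auto simp: \<phi>_def)
      next
        case 2
        then have "y \<in> orbit_of q i" using j xy by (auto simp: \<phi>_def split: if_splits)
        then show ?thesis using 2 py by (auto simp: \<phi>_def)
      next
        case 3
        then have "j \<in> orbit_of q i" using j by (auto simp: \<phi>_def split: if_splits)
        then show ?thesis using 3 pz orbit_of_step[of j q i] by (auto simp: \<phi>_def)
      qed
    qed
  next
    \<comment> \<open>An orbit of \<open>p\<close> without \<open>x\<close> is closed under
      \<open>q\<close>: at \<open>y\<close>, one step of \<open>q\<close> is two steps of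
      \<open>p\<close>, through \<open>x\<close>.\<close>
    have "orbit_of q i \<subseteq> orbit_of p i \<inter> - {x}"
    proof (rule orbit_of_least)
      show "i \<in> orbit_of p i \<inter> - {x}" using that orbit_of_self by auto
      fix j assume j: "j \<in> orbit_of p i \<inter> - {x}"
      have "q j \<noteq> x" using j inj[of j x] qx by auto
      moreover have "q j \<in> orbit_of p i"

      proof (cases "j = y")
        case True
        then have "p (p j) \<in> orbit_of p i" using j orbit_of_step[of _ p i] by blast
        then show ?thesis using True px py by simp
      next
        case False
        then show ?thesis using j pz[of j] orbit_of_step[of j p i] by auto
      qed
      ultimately show "q j \<in> orbit_of p i \<inter> - {x}" by simp
    qed
    then show "\<phi> (orbit_of q i) \<subseteq> orbit_of p i"
      using py orbit_of_step[of y p i] by (auto simp: \<phi>_def)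
  qed
  have pS: "p permutes S" using q xy by (simp add: p permutes_compose permutes_swap_id)
  have "orbit_of p x = orbit_of p y"
    using orbit_of_eq[OF pS S, of x y] orbit_of_step[OF orbit_of_self, of p y] py by simp
  moreover have "orbit_of p y \<in> orbit_of p ` (S - {x})" using xy by blast
  moreover have "S = insert x (S - {x})" using xy by blast
  ultimately have "orbit_of p ` S = orbit_of p ` (S - {x})"
    by (metis image_insert insert_absorb)
  also have "\<dots> = (\<lambda>i. \<phi> (orbit_of q i)) ` (S - {x})"
    by (rule image_cong[OF refl], rule eq) blast
  also have "\<dots> = \<phi> ` orbit_of q ` (S - {x})" by (simp only: image_image)
  finally have im: "orbit_of p ` S = \<phi> ` orbit_of q ` (S - {x})" .
  \<comment> \<open>The orbits in question avoid \<open>x\<close>, so deleting \<open>x\<close>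
    undoes \<open>\<phi>\<close>.\<close>
  have "inj_on \<phi> (orbit_of q ` (S - {x}))"
  proof (rule inj_onI)
    fix C D assume CD: "C \<in> orbit_of q ` (S - {x})" "D \<in> orbit_of q ` (S - {x})" "\<phi> C = \<phi> D"
    obtain i k where "C = orbit_of q i" "D = orbit_of q k" "i \<noteq> x" "k \<noteq> x"
      using CD(1,2) by auto
    then have "x \<notin> C" "x \<notin> D" using nx by simp_all
    then have "C = \<phi> C - {x}" "D = \<phi> D - {x}" by (simp_all add: \<phi>_def)
    then show "C = D" by (metis CD(3))
  qed
  then have c: "card (orbit_of p ` S) = card (orbit_of q ` (S - {x}))"
    unfolding im by (rule card_image)
  have "orbit_of q ` S = insert {x} (orbit_of q ` (S - {x}))"
    using xy orbit_of_fixed[of q, OF qx] by (metis image_insert insert_Diff)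
  moreover have "{x} \<notin> orbit_of q ` (S - {x})"
  proof
    assume "{x} \<in> orbit_of q ` (S - {x})"
    then obtain i where "i \<noteq> x" "orbit_of q i = {x}" by auto
    then show False using nx[of i] by simp
  qed
  ultimately show ?thesis using c S by simp
qed

section \<open>Inversions under an exchange of two entries\<close>

lemma card_inversion_set:
  assumes "finite S"
  shows "int (card (inversion_set S p)) = (\<Sum>x\<in>S. \<Sum>y\<in>S. of_bool (x < y \<and> p y < p x))"
proof -
  have "inversion_set S p = (SIGMA x:S. {y\<in>S. x < y \<and> p y < p x})"
    by (auto simp: inversion_set_def)
  then show ?thesis using assms by (simp add: card_SigmaI Int_def)
qed

text \<open>The exchange destroys the inversion \<open>(i, j)\<close>. An entry between the two both
  in position and in value loses its inversions with both; for every other position the number of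
  inversions with \<open>i\<close> and \<open>j\<close> together is unchanged.\<close>

lemma card_inversion_set_transpose:
  assumes S: "finite S" and ij: "i \<in> S" "j \<in> S" "i < j" "p j < p i" and inj: "\<And>a b. p a = p b \<longleftrightarrow> a = b"
    and q: "q = p \<circ> transpose i j"
  shows "card (inversion_set S p) =
    card (inversion_set S q) + 1 + 2 * card {x\<in>S. i < x \<and> x < j \<and> p j < p x \<and> p x < p i}"
proof -
  define R where "R = S - {i, j}"
  have SR: "S = insert i (insert j R)" and R: "finite R" "i \<notin> R" "j \<notin> R" using S ij by (auto simp: R_def)
  define h where "h f x y = (of_bool (x < y \<and> f y < f x) :: int)" for f :: "nat \<Rightarrow> nat" and x y :: nat
  have split: "int (card (inversion_set S f)) = (\<Sum>x\<in>R. \<Sum>y\<in>R. h f x y)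
      + (\<Sum>x\<in>R. h f x i + h f x j + h f i x + h f j x) + h f i j + h f j i" for f
  proof -
    have "int (card (inversion_set S f)) = (\<Sum>x\<in>S. \<Sum>y\<in>S. h f x y)"
      using S by (simp add: card_inversion_set h_def)
    also have "\<dots> = (\<Sum>x\<in>R. \<Sum>y\<in>R. h f x y)
      + (\<Sum>x\<in>R. h f x i + h f x j + h f i x + h f j x) + h f i j + h f j i + h f i i + h f j j"
      unfolding SR using R ij(3) by (simp add: sum.distrib)
    finally show ?thesis by (simp add: h_def)
  qed
  have qi: "q i = p j" "q j = p i" "x \<in> R \<Longrightarrow> q x = p x" for x
    using R by (auto simp: q transpose_def)
  have pt: "h p x i + h p x j + h p i x + h p j x =
     h q x i + h q x j + h q i x + h q j x + 2 * of_bool (i < x \<and> x < j \<and> p j < p x \<and> p x < p i)"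
    if "x \<in> R" for x
  proof -
    have "x \<noteq> i" "x \<noteq> j" "q x = p x" using that R qi by auto
    moreover have "p x \<noteq> p i" "p x \<noteq> p j" using inj calculation by auto
    ultimately show ?thesis using ij(3,4) unfolding h_def qi(1,2)
      by (cases "x < i"; cases "x < j"; cases "p x < p i"; cases "p x < p j") auto
  qed
  have c: "{x\<in>S. i < x \<and> x < j \<and> p j < p x \<and> p x < p i} = {x\<in>R. i < x \<and> x < j \<and> p j < p x \<and> p x < p i}"
    by (auto simp: R_def)
  have "int (card (inversion_set S p)) = int (card (inversion_set S q)) + 1
    + 2 * int (card {x\<in>S. i < x \<and> x < j \<and> p j < p x \<and> p x < p i})"
    unfolding split c using R(1) qi ij
    by (simp add: pt sum.distrib sum_distrib_left[symmetric] Int_def) (simp add: h_def)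
  then show ?thesis by linarith
qed

section \<open>Moving an extreme value into place\<close>

lemma permutes_less_max:
  assumes "p permutes {l..u::nat}" "p j = u" "x \<in> {l..u}" "x \<noteq> j"
  shows "p x < u"
proof -
  have "p x \<le> u" using permutes_in_image[OF assms(1), of x] assms(3) by simp
  moreover have "p x \<noteq> u" using assms(2,4) inj_eq[OF permutes_inj[OF assms(1)], of x j] by simp
  ultimately show ?thesis by simp
qed

lemma permutes_greater_min:
  assumes "p permutes {l..u::nat}" "p j = l" "x \<in> {l..u}" "x \<noteq> j"
  shows "l < p x"
proof -
  have "l \<le> p x" using permutes_in_image[OF assms(1), of x] assms(3) by simp
  moreover have "p x \<noteq> l" using assms(2,4) inj_eq[OF permutes_inj[OF assms(1)], of x j] by simp
  ultimately show ?thesis by simp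
qed

text \<open>Moving the maximum to position \<open>u\<close> lowers the displacement by
  \<open>2 * (u - max (p u) j)\<close>, the inversions by one plus twice the displayed cardinality,
  and \<open>T\<close> by one, since \<open>u\<close> splits off as a cycle of its own.\<close>

lemma defect_transpose_right:
  assumes p: "p permutes {l..u}" and j: "l \<le> j" "j < u" "p j = u"
  shows "defect {l..u} p = defect {l..u} (p \<circ> transpose j u)
    + 2 * (int u - 1 - int (max (p u) j) - int (card {x. j < x \<and> x < u \<and> p u < p x}))"
proof -
  define q where "q = p \<circ> transpose j u"
  define R where "R = {l..u} - {j, u}"
  have SR: "{l..u} = insert j (insert u R)" and R: "finite R" "j \<notin> R" "u \<notin> R" using j by (auto simp: R_def)
  have inj: "p x = p y \<longleftrightarrow> x = y" for x y using permutes_inj[OF p] by (rule inj_eq)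
  have pu: "p u < u" using permutes_less_max[OF p j(3), of u] j by simp
  have qv: "q j = p u" "q u = u" "x \<in> R \<Longrightarrow> q x = p x" for x
    using R j by (auto simp: q_def transpose_def)
  have qp: "q permutes {l..u}"
    unfolding q_def using p j by (intro permutes_compose permutes_swap_id) auto
  have pq: "p = q \<circ> transpose u j" unfolding q_def by (auto simp: transpose_def)
  have T: "card (orbit_of q ` {l..u}) = Suc (card (orbit_of p ` {l..u}))"
    by (rule card_orbits_transpose[OF qp _ _ _ _ qv(2) pq]) (use j in auto)
  have "{x\<in>{l..u}. j < x \<and> x < u \<and> p u < p x \<and> p x < p j} = {x. j < x \<and> x < u \<and> p u < p x}" (is "?X = ?Y")
  proof
    have "p x < u" if "l \<le> x" "x < u" "j < x" for x
      using permutes_less_max[OF p j(3), of x] that by simp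
    then show "?Y \<subseteq> ?X" using j by auto
  qed auto
  then have I: "card (inversion_set {l..u} p) = card (inversion_set {l..u} q) + 1
      + 2 * card {x. j < x \<and> x < u \<and> p u < p x}"
    using card_inversion_set_transpose[of "{l..u}" j u p q] j pu inj q_def by auto
  have D: "(\<Sum>i\<in>{l..u}. \<bar>int (p i) - int i\<bar>) = (\<Sum>i\<in>{l..u}. \<bar>int (q i) - int i\<bar>) + 2 * (int u - int (max (p u) j))"
    unfolding SR using R qv j pu by (auto simp: max_def)
  show ?thesis unfolding defect_def q_def[symmetric] T I D by simp
qed

text \<open>Mirror image of \<open>defect_transpose_right\<close> under reversing both positions and
  values, which preserves displacement, inversions and cycle type.\<close>

lemma defect_transpose_left:
  assumes p: "p permutes {l..u}" and j: "l < j" "j \<le> u" "p j = l"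
  shows "defect {l..u} p = defect {l..u} (p \<circ> transpose l j)
    + 2 * (int (min (p l) j) - int l - 1 - int (card {x. l < x \<and> x < j \<and> p x < p l}))"
proof -
  define q where "q = p \<circ> transpose l j"
  define R where "R = {l..u} - {l, j}"
  have SR: "{l..u} = insert l (insert j R)" and R: "finite R" "l \<notin> R" "j \<notin> R" using j by (auto simp: R_def)
  have inj: "p x = p y \<longleftrightarrow> x = y" for x y using permutes_inj[OF p] by (rule inj_eq)
  have pl: "l < p l" using permutes_greater_min[OF p j(3), of l] j by simp
  have qv: "q j = p l" "q l = l" "x \<in> R \<Longrightarrow> q x = p x" for x
    using R j by (auto simp: q_def transpose_def)
  have qp: "q permutes {l..u}"
    unfolding q_def using p j by (intro permutes_compose permutes_swap_id) auto
  have pq: "p = q \<circ> transpose l j" unfolding q_def by (auto simp: transpose_def)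
  have T: "card (orbit_of q ` {l..u}) = Suc (card (orbit_of p ` {l..u}))"
    by (rule card_orbits_transpose[OF qp _ _ _ _ qv(2) pq]) (use j in auto)
  have "{x\<in>{l..u}. l < x \<and> x < j \<and> p j < p x \<and> p x < p l} = {x. l < x \<and> x < j \<and> p x < p l}" (is "?X = ?Y")
  proof
    have "p x > l" if "l < x" "x < j" for x
      using permutes_greater_min[OF p j(3), of x] that j by simp
    then show "?Y \<subseteq> ?X" using j by auto
  qed auto
  then have I: "card (inversion_set {l..u} p) = card (inversion_set {l..u} q) + 1
      + 2 * card {x. l < x \<and> x < j \<and> p x < p l}"
    using card_inversion_set_transpose[of "{l..u}" l j p q] j pl inj q_def by auto
  have D: "(\<Sum>i\<in>{l..u}. \<bar>int (p i) - int i\<bar>) = (\<Sum>i\<in>{l..u}. \<bar>int (q i) - int i\<bar>) + 2 * (int (min (p l) j) - int l)"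
    unfolding SR using R qv j pl by (auto simp: min_def)
  show ?thesis unfolding defect_def q_def[symmetric] T I D by simp
qed

text \<open>A fixed point on one side of all of \<open>S\<close> has displacement zero, is in no
  inversion, and adds one element and one cycle, which cancel in \<open>T\<close>.\<close>

lemma defect_insert_fixed:
  assumes p: "p permutes S" and S: "finite S" "x \<notin> S" and x: "(\<forall>y\<in>S. y < x) \<or> (\<forall>y\<in>S. x < y)"
  shows "defect (insert x S) p = defect S p"
proof -
  have px: "p x = x" using p S by (simp add: permutes_not_in)
  have "\<not> (y < x \<and> p x < p y) \<and> \<not> (x < y \<and> p y < p x)" if "y \<in> S" for y
  proof -
    have "p y \<in> S" using permutes_in_image[OF p] that by simp
    then show ?thesis using x that unfolding px by (meson less_asym)
  qed
  then have "inversion_set (insert x S) p = inversion_set S p"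
    unfolding inversion_set_def by auto
  moreover have "{x} \<notin> orbit_of p ` S" using orbit_of_self[of _ p] S(2) by (metis imageE singletonD)
  ultimately show ?thesis using S px by (simp add: defect_def orbit_of_fixed)
qed

lemma permutes_fixed_right:
  assumes "p permutes {l..u::nat}" "p u = u" "l < u"
  shows "p permutes {l..u-1}"
proof (rule permutes_superset[OF assms(1)])
  fix x assume "x \<in> {l..u} - {l..u-1}"
  then have "x = u" by auto
  then show "p x = x" using assms(2) by simp
qed

lemma permutes_fixed_left:
  assumes "p permutes {l..u::nat}" "p l = l"
  shows "p permutes {Suc l..u}"
proof (rule permutes_superset[OF assms(1)])
  fix x assume "x \<in> {l..u} - {Suc l..u}"
  then have "x = l" by auto
  then show "p x = x" using assms(2) by simp
qed

lemma defect_fixed_right: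
  assumes "p permutes {l..u-1}" "l < u"
  shows "defect {l..u} p = defect {l..u-1} p"
proof -
  have "{l..u} = insert u {l..u-1}" using assms(2) by auto
  then show ?thesis using defect_insert_fixed[OF assms(1), of u] assms(2) by auto
qed

lemma defect_fixed_left:
  assumes "p permutes {Suc l..u}" "l \<le> u"
  shows "defect {l..u} p = defect {Suc l..u} p"
proof -
  have "{l..u} = insert l {Suc l..u}" using assms(2) by auto
  then show ?thesis using defect_insert_fixed[OF assms(1), of l] by auto
qed

lemma preimage_in_interval:
  assumes "p permutes S" "v \<in> S" obtains j where "j \<in> S" "p j = v"
  using permutes_image[OF assms(1)] assms(2) by (metis imageE)

text \<open>The counted positions lie strictly between \<open>j\<close> and \<open>u\<close>, and
  their values strictly between \<open>p u\<close> and \<open>u\<close>; each of the two intervals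
  bounds their number.\<close>

lemma card_right_le:
  assumes p: "p permutes {l..u}" and j: "l \<le> j" "j < u" "p j = u"
  shows "int (card {x. j < x \<and> x < u \<and> p u < p x}) \<le> int u - 1 - int (max (p u) j)"
proof -
  let ?Y = "{x. j < x \<and> x < u \<and> p u < p x}"
  have 1: "card ?Y \<le> card {j<..<u}" by (rule card_mono) auto
  have "p x < u" if "l \<le> x" "x < u" "j < x" for x
    using permutes_less_max[OF p j(3), of x] that by simp
  then have "p ` ?Y \<subseteq> {p u<..<u}" using j by auto
  then have 2: "card ?Y \<le> card {p u<..<u}"
    using card_inj_on_le[of p ?Y "{p u<..<u}"] permutes_inj_on[OF p] by auto
  have "p u < u" using permutes_less_max[OF p j(3), of u] j by simp
  with 1 2 j show ?thesis by auto
qed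

lemma defect_nonneg: "p permutes {l..u} \<Longrightarrow> 0 \<le> defect {l..u} p"
proof (induction u arbitrary: p rule: less_induct)
  case (less u)
  show ?case
  proof (cases "l < u")
    case False
    then consider "{l..u} = {}" | "l = u" by fastforce
    then show ?thesis
    proof cases
      case 1 then show ?thesis unfolding defect_def by (simp add: inversion_set_def)
    next
      case 2
      then have "p = id" using less.prems by simp
      moreover have "inversion_set {u} (\<lambda>a. a) = {}" by (auto simp: inversion_set_def)
      ultimately show ?thesis using 2 by (simp add: defect_def)
    qed
  next
    case lu: True
    have fixed: "0 \<le> defect {l..u} q" if "q permutes {l..u}" "q u = u" for q
      using less.IH[of "u - 1" q] permutes_fixed_right[OF that lu] defect_fixed_right[of q l u] lu by auto
    show ?thesis
    proof (cases "p u = u")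
      case True then show ?thesis using fixed less.prems by blast
    next
      case False
      obtain j where j: "j \<in> {l..u}" "p j = u" using preimage_in_interval[OF less.prems, of u] lu by auto
      then have j': "l \<le> j" "j < u" using False by (auto simp: le_less)
      have "p \<circ> transpose j u permutes {l..u}"
        using less.prems j' by (intro permutes_compose permutes_swap_id) auto
      then have "0 \<le> defect {l..u} (p \<circ> transpose j u)" using fixed j by auto
      then show ?thesis
        using defect_transpose_right[OF less.prems j' j(2)] card_right_le[OF less.prems j' j(2)] by simp
    qed
  qed
qed

subsection \<open>Shallow 132-avoiding permutations of an interval\<close>

definition avoids_on :: "nat \<Rightarrow> nat \<Rightarrow> (nat \<Rightarrow> nat) \<Rightarrow> bool" where
  "avoids_on l u p \<longleftrightarrow> \<not> (\<exists>i j k. l \<le> i \<and> i < j \<and> j < k \<and> k \<le> u \<and> p i < p k \<and> p k < p j)"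

definition descents_on :: "nat \<Rightarrow> nat \<Rightarrow> (nat \<Rightarrow> nat) \<Rightarrow> nat set" where
  "descents_on l u p = {i. l \<le> i \<and> i < u \<and> p (Suc i) < p i}"

definition shallow132 :: "nat \<Rightarrow> nat \<Rightarrow> (nat \<Rightarrow> nat) set" where
  "shallow132 l u = {p. p permutes {l..u} \<and> defect {l..u} p = 0 \<and> avoids_on l u p}"

section \<open>Avoidance and descents when an end entry is dropped\<close>

lemma avoids_onD:
  "avoids_on l u p \<Longrightarrow> l \<le> i \<Longrightarrow> i < j \<Longrightarrow> j < k \<Longrightarrow> k \<le> u \<Longrightarrow> p i < p k \<Longrightarrow> p k < p j \<Longrightarrow> False"
  unfolding avoids_on_def by blast

text \<open>The last position of an occurrence of 132 carries the intermediate value, so an entry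
  below or above all others cannot play that role.\<close>

lemma avoids_on_last:
  assumes "(\<forall>i\<in>{l..v}. p (Suc v) < p i) \<or> (\<forall>i\<in>{l..v}. p i < p (Suc v))"
  shows "avoids_on l (Suc v) p \<longleftrightarrow> avoids_on l v p"
proof -
  have "k \<noteq> Suc v" if "l \<le> i" "i < j" "j < k" "k \<le> Suc v" "p i < p k" "p k < p j" for i j k
  proof
    assume "k = Suc v"
    then have "i \<in> {l..v}" "j \<in> {l..v}" "p i < p (Suc v)" "p (Suc v) < p j" using that by auto
    with assms show False by (meson less_asym)
  qed
  then show ?thesis unfolding avoids_on_def by (metis le_Suc_eq)
qed

lemma avoids_on_first:
  assumes "\<And>j k. l < j \<Longrightarrow> j < k \<Longrightarrow> k \<le> u \<Longrightarrow> p l < p k \<Longrightarrow> p k < p j \<Longrightarrow> False"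
  shows "avoids_on l u p \<longleftrightarrow> avoids_on (Suc l) u p"
  unfolding avoids_on_def using assms by (metis Suc_leD Suc_leI le_neq_implies_less)

lemma avoids_on_cong:
  assumes "\<And>x y. l \<le> x \<Longrightarrow> x \<le> u \<Longrightarrow> l \<le> y \<Longrightarrow> y \<le> u \<Longrightarrow> p x < p y \<longleftrightarrow> q x < q y"
  shows "avoids_on l u p \<longleftrightarrow> avoids_on l u q"
proof -
  have "p i < p k \<and> p k < p j \<longleftrightarrow> q i < q k \<and> q k < q j"
    if "l \<le> i" "i < j" "j < k" "k \<le> u" for i j k
    using that assms[of i k] assms[of k j] by simp
  then show ?thesis unfolding avoids_on_def by meson
qed

lemma descents_on_cong:
  assumes "\<And>x y. l \<le> x \<Longrightarrow> x \<le> u \<Longrightarrow> l \<le> y \<Longrightarrow> y \<le> u \<Longrightarrow> p x < p y \<longleftrightarrow> q x < q y"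
  shows "descents_on l u p = descents_on l u q"
  unfolding descents_on_def using assms by (intro Collect_cong) auto

lemma finite_descents_on [simp]: "finite (descents_on l u p)"
  unfolding descents_on_def by simp

lemma card_descents_on_last:
  assumes "l \<le> v"
  shows "card (descents_on l (Suc v) p) = card (descents_on l v p) + of_bool (p (Suc v) < p v)"
proof -
  have "descents_on l (Suc v) p = (if p (Suc v) < p v then insert v (descents_on l v p) else descents_on l v p)"
    using assms by (auto simp: descents_on_def less_Suc_eq)
  moreover have "v \<notin> descents_on l v p" by (simp add: descents_on_def)
  ultimately show ?thesis by simp
qed

lemma card_descents_on_first:
  assumes "l < u"
  shows "card (descents_on l u p) = card (descents_on (Suc l) u p) + of_bool (p (Suc l) < p l)"
proof -
  have "descents_on l u p = (if p (Suc l) < p l then insert l (descents_on (Suc l) u p) else descents_on (Suc l) u p)"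
    using assms by (auto simp: descents_on_def Suc_le_eq le_less)
  moreover have "l \<notin> descents_on (Suc l) u p" by (simp add: descents_on_def)
  ultimately show ?thesis by simp
qed

section \<open>Zero defect and the places of the maximum and minimum\<close>

lemma defect_zero_right:
  assumes p: "p permutes {l..u}" and j: "l \<le> j" "j < u" "p j = u"
  shows "defect {l..u} p = 0 \<longleftrightarrow> defect {l..u} (p \<circ> transpose j u) = 0 \<and>
    int (card {x. j < x \<and> x < u \<and> p u < p x}) = int u - 1 - int (max (p u) j)"
proof -
  have "p \<circ> transpose j u permutes {l..u}"
    using p j by (intro permutes_compose permutes_swap_id) auto
  \<comment> \<open>The defect after the exchange and the slack in the count are both nonnegative,
    so their sum vanishes only if each does.\<close>
  from defect_nonneg[OF this] show ?thesis
    using defect_transpose_right[OF p j] card_right_le[OF p j] by (smt (verit))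
qed

text \<open>The counted positions lie strictly between \<open>l\<close> and \<open>j\<close>, their
  values strictly between \<open>l\<close> and \<open>p l\<close>; so the slack is again nonnegative
  and must vanish separately.\<close>

lemma defect_zero_left:
  assumes p: "p permutes {l..u}" and j: "l < j" "j \<le> u" "p j = l"
  shows "defect {l..u} p = 0 \<longleftrightarrow> defect {l..u} (p \<circ> transpose l j) = 0 \<and>
    int (card {x. l < x \<and> x < j \<and> p x < p l}) = int (min (p l) j) - int l - 1"
proof -
  let ?Y = "{x. l < x \<and> x < j \<and> p x < p l}"
  have 1: "card ?Y \<le> card {l<..<j}" by (rule card_mono) auto
  have "l < p x" if "l < x" "x < j" for x
    using permutes_greater_min[OF p j(3), of x] that j by simp
  then have "p ` ?Y \<subseteq> {l<..<p l}" by auto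
  then have 2: "card ?Y \<le> card {l<..<p l}"
    using card_inj_on_le[of p ?Y "{l<..<p l}"] permutes_inj_on[OF p] by auto
  have "l < p l" using permutes_greater_min[OF p j(3), of l] j by simp
  with 1 2 j have "int (card ?Y) \<le> int (min (p l) j) - int l - 1" by auto
  moreover have "p \<circ> transpose l j permutes {l..u}"
    using p j by (intro permutes_compose permutes_swap_id) auto
  note defect_nonneg[OF this]
  ultimately show ?thesis
    using defect_transpose_left[OF p j] by (smt (verit))
qed

text \<open>An entry before the maximum that is smaller than one after it would form a 132 with the
  maximum as the 3.\<close>

lemma avoids_on_max:
  assumes p: "p permutes {l..u}" and a: "avoids_on l u p" and j: "p j = u" "j \<le> u"
    and "l \<le> i" "i < j" "j < k" "k \<le> u"
  shows "p k < p i"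
proof (rule ccontr)
  assume "\<not> p k < p i"
  moreover have "p k \<noteq> p i" using inj_eq[OF permutes_inj[OF p], of k i] assms by simp
  moreover have "p k < u" using permutes_less_max[OF p j(1), of k] assms by simp
  ultimately show False using avoids_onD[OF a, of i j k] assms by simp
qed

text \<open>Otherwise both bounds on the number of positions after \<open>j\<close> with value above
  \<open>p u\<close> are strict: the position of the minimum is not counted, and the value
  \<open>p l\<close> is not taken there. Zero defect requires the smaller bound to be
  attained.\<close>

lemma shallow132_cases:
  assumes p: "p \<in> shallow132 l u" and lu: "l < u" and pu: "p u \<noteq> u"
  shows "p l = u \<or> p u = l"
proof (rule ccontr)
  assume *: "\<not> ?thesis"
  have perm: "p permutes {l..u}" and d: "defect {l..u} p = 0" and av: "avoids_on l u p"
    using p by (auto simp: shallow132_def)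
  obtain j where j: "j \<in> {l..u}" "p j = u" using preimage_in_interval[OF perm, of u] lu by auto
  have j': "l < j" "j < u" using j * pu by (auto simp: le_less)
  obtain i where i: "i \<in> {l..u}" "p i = l" using preimage_in_interval[OF perm, of l] lu by auto
  let ?Y = "{x. j < x \<and> x < u \<and> p u < p x}"
  have c: "int (card ?Y) = int u - 1 - int (max (p u) j)"
    using defect_zero_right[OF perm _ j'(2) j(2)] d j' by simp
  have pu': "l < p u" using permutes_greater_min[OF perm i(2), of u] * i lu by auto
  have big: "p k < p x" if "l \<le> x" "x < j" "j < k" "k \<le> u" for x k
    using avoids_on_max[OF perm av j(2) _ that(1-4)] j by simp
  \<comment> \<open>Entries before the maximum exceed the last entry, which itself exceeds
    \<open>l\<close>, so the minimum comes after the maximum.\<close>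
  have ij: "j < i" "i < u"
  proof -
    show "j < i"
    proof (rule ccontr)
      assume "\<not> j < i"
      moreover have "i \<noteq> j" using i j lu by auto
      ultimately have "p u < p i" using big[of i u] i j' by simp
      then show False using i pu' by simp
    qed
    have "i \<noteq> u" using i * by auto
    then show "i < u" using i by simp
  qed
  have "card ?Y \<le> card ({j<..<u} - {i})" by (rule card_mono) (use pu' i in auto)
  then have 1: "card ?Y \<le> u - Suc j - 1" using ij by simp
  have pl: "p u < p l" "p l < u" using big[of l u] j' permutes_less_max[OF perm j(2), of l] lu by auto
  have "p ` ?Y \<subseteq> {p u<..<u} - {p l}"
    using permutes_less_max[OF perm j(2)] j' inj_eq[OF permutes_inj[OF perm]] by auto
  then have "card ?Y \<le> card ({p u<..<u} - {p l})"
    using card_inj_on_le[of p ?Y] permutes_inj_on[OF perm] by auto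
  then have "card ?Y \<le> u - Suc (p u) - 1" using pl by simp
  with 1 c ij pl show False by (auto simp: max_def split: if_splits)
qed

section \<open>Reductions to smaller intervals\<close>

lemma comp_transpose:
  assumes "inj p"
  shows "p \<circ> transpose a b = transpose (p a) (p b) \<circ> p"
  by (auto simp: fun_eq_iff transpose_def inj_eq[OF assms])

lemma permutes_Suc_fixed:
  assumes "p permutes {l..Suc v}" "p (Suc v) = Suc v" "l \<le> v"
  shows "p permutes {l..v}" and "defect {l..Suc v} p = defect {l..v} p"
  using permutes_fixed_right[OF assms(1,2)] defect_fixed_right[of p l "Suc v"] assms(3) by auto

text \<open>A maximum in last place is a fixed point: it adds no defect, cannot end a 132, and is
  not the bottom of a descent.\<close>

lemma shallow132_fixed_last:
  assumes "l \<le> v"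
  shows "p \<in> shallow132 l (Suc v) \<and> p (Suc v) = Suc v \<longleftrightarrow> p \<in> shallow132 l v"
    and "p \<in> shallow132 l v \<Longrightarrow> card (descents_on l (Suc v) p) = card (descents_on l v p)"
proof -
  have *: "p (Suc v) = Suc v" "p permutes {l..Suc v}" if "p permutes {l..v}"
    using that permutes_subset[OF that, of "{l..Suc v}"] by (auto simp: permutes_not_in)
  have less: "\<forall>i\<in>{l..v}. p i < Suc v" if "p permutes {l..v}"
  proof
    fix i assume "i \<in> {l..v}"
    then show "p i < Suc v" using permutes_in_image[OF that, of i] by simp
  qed
  show "p \<in> shallow132 l (Suc v) \<and> p (Suc v) = Suc v \<longleftrightarrow> p \<in> shallow132 l v"
    using * less avoids_on_last[of l v p] permutes_Suc_fixed[OF _ _ assms, of p]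
    unfolding shallow132_def by (metis (no_types, lifting) mem_Collect_eq)
  show "card (descents_on l (Suc v) p) = card (descents_on l v p)" if "p \<in> shallow132 l v"
  proof -
    have "p permutes {l..v}" using that by (simp add: shallow132_def)
    then have "p (Suc v) = Suc v" "p v < Suc v" using *(1) less assms by simp_all
    then show ?thesis by (simp add: card_descents_on_last[OF assms])
  qed
qed

text \<open>In one-line notation, the permutations \<open>p\<close> of the next three reductions (\<open>shallow132_both_ends\<close>,
  \<open>shallow132_max_min_end\<close>, \<open>shallow132_first_min_end\<close>) are \<open>n R 1\<close>, \<open>L n 1\<close> and \<open>(n-1) L n R 1\<close>.\<close>

lemma shallow132_both_ends:
  assumes p: "p permutes {l..Suc v}" "p l = Suc v" "p (Suc v) = l" and lv: "l < v"
  defines "q \<equiv> p \<circ> transpose l (Suc v)"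
  shows "q permutes {Suc l..v}"
    and "p \<in> shallow132 l (Suc v) \<longleftrightarrow> q \<in> shallow132 (Suc l) v"
    and "card (descents_on l (Suc v) p) = card (descents_on (Suc l) v q) + 2"
proof -
  have q1: "q permutes {l..Suc v}"
    unfolding q_def using p lv by (intro permutes_compose permutes_swap_id) auto
  have qv: "q l = l" "q (Suc v) = Suc v" using p by (auto simp: q_def)
  have qx: "q x = p x" if "l < x" "x \<le> v" for x using that by (auto simp: q_def transpose_def)
  have q2: "q permutes {l..v}" using permutes_Suc_fixed(1)[OF q1 qv(2)] lv by simp
  show q3: "q permutes {Suc l..v}" by (rule permutes_fixed_left[OF q2 qv(1)])
  \<comment> \<open>The last entry is the minimum, so all \<open>v - l\<close> positions strictly
    between the ends count, which is exactly the required number.\<close>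
  have "{x. l < x \<and> x < Suc v \<and> p (Suc v) < p x} = {l<..<Suc v}"
    using permutes_greater_min[OF p(1,3)] p(3) by auto
  then have d: "defect {l..Suc v} p = 0 \<longleftrightarrow> defect {Suc l..v} q = 0"
    using defect_zero_right[OF p(1) _ _ p(2)] lv p(3) permutes_Suc_fixed(2)[OF q1 qv(2)]
      defect_fixed_left[OF q3] by (simp add: q_def[symmetric])
  have "avoids_on l (Suc v) p \<longleftrightarrow> avoids_on l v p"
    using permutes_greater_min[OF p(1,3)] p(3) by (intro avoids_on_last) simp
  also have "\<dots> \<longleftrightarrow> avoids_on (Suc l) v p"
  proof (rule avoids_on_first)
    fix j k assume "l < j" "j < k" "k \<le> v" "p l < p k"
    then show False using permutes_less_max[OF p(1,2), of k] p(2) by simp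
  qed
  also have "\<dots> \<longleftrightarrow> avoids_on (Suc l) v q" by (rule avoids_on_cong) (simp add: qx)
  finally show "p \<in> shallow132 l (Suc v) \<longleftrightarrow> q \<in> shallow132 (Suc l) v"
    using p(1) q3 d by (simp add: shallow132_def)
  have "descents_on (Suc l) v p = descents_on (Suc l) v q"
    by (rule descents_on_cong) (simp add: qx)
  then show "card (descents_on l (Suc v) p) = card (descents_on (Suc l) v q) + 2"
    using lv permutes_greater_min[OF p(1,3), of v] permutes_less_max[OF p(1,2), of "Suc l"] p
    by (simp add: card_descents_on_last[of l v] card_descents_on_first[of l v])
qed

lemma shallow132_max_min_end:
  assumes p: "p permutes {l..Suc v}" "p v = Suc v" "p (Suc v) = l" and lv: "l < v"
  defines "q \<equiv> p \<circ> transpose v (Suc v)"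
  shows "q permutes {l..v}" and "q v = l"
    and "p \<in> shallow132 l (Suc v) \<longleftrightarrow> q \<in> shallow132 l v"
    and "card (descents_on l (Suc v) p) = card (descents_on l v q)"
proof -
  obtain w where w: "v = Suc w" "l \<le> w" using lv by (cases v) auto
  have q1: "q permutes {l..Suc v}"
    unfolding q_def using p lv by (intro permutes_compose permutes_swap_id) auto
  have qv: "q (Suc v) = Suc v" using p by (auto simp: q_def)
  show qv': "q v = l" using p by (auto simp: q_def)
  have qx: "q x = p x" if "x < v" for x using that by (auto simp: q_def transpose_def)
  show q2: "q permutes {l..v}" using permutes_Suc_fixed(1)[OF q1 qv] lv by simp
  have "{x. v < x \<and> x < Suc v \<and> p (Suc v) < p x} = {}" by auto
  then have d: "defect {l..Suc v} p = 0 \<longleftrightarrow> defect {l..v} q = 0"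
    using defect_zero_right[OF p(1) _ _ p(2)] lv p(3) permutes_Suc_fixed(2)[OF q1 qv]
    by (simp add: q_def[symmetric])
  \<comment> \<open>Strip the trailing minimum, then the maximum, and append the minimum again at
    position \<open>v\<close>.\<close>
  have "avoids_on l (Suc v) p \<longleftrightarrow> avoids_on l v p"
    using permutes_greater_min[OF p(1,3)] p(3) by (intro avoids_on_last) simp
  also have "\<dots> \<longleftrightarrow> avoids_on l w p"
    using permutes_less_max[OF p(1,2)] p(2) unfolding w by (intro avoids_on_last) simp
  also have "\<dots> \<longleftrightarrow> avoids_on l w q" by (rule avoids_on_cong) (simp add: qx w)
  also have "\<dots> \<longleftrightarrow> avoids_on l v q"
    using permutes_greater_min[OF q2 qv'] qv' unfolding w by (intro avoids_on_last[symmetric]) simp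
  finally show "p \<in> shallow132 l (Suc v) \<longleftrightarrow> q \<in> shallow132 l v"
    using p(1) q2 d by (simp add: shallow132_def)
  \<comment> \<open>The last descent of \<open>p\<close> goes from the maximum to the minimum, that
    of \<open>q\<close> from the end of \<open>L\<close> to the minimum, so the counts
    agree.\<close>
  have "descents_on l w p = descents_on l w q"
    by (rule descents_on_cong) (simp add: qx w)
  then show "card (descents_on l (Suc v) p) = card (descents_on l v q)"
    using w permutes_greater_min[OF q2 qv', of w] permutes_less_max[OF p(1,2), of w] p qv'
    by (simp add: card_descents_on_last)
qed

text \<open>Moving the maximum to the end puts the minimum at its old position \<open>j\<close>. If
  the first entry were below \<open>v\<close>, both bounds in \<open>defect_zero_left\<close> would
  then be strict: the position of \<open>v\<close>, between \<open>l\<close> and \<open>j\<close>,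
  is not counted, and the value \<open>p v\<close>, between \<open>l\<close> and \<open>p l\<close>,
  is not taken there.\<close>

lemma shallow132_first_eq:
  assumes p: "p \<in> shallow132 l (Suc v)" "p (Suc v) = l" "p l \<noteq> Suc v" "p v \<noteq> Suc v" and lv: "l \<le> v"
  shows "p l = v"
proof (rule ccontr)
  assume *: "p l \<noteq> v"
  have perm: "p permutes {l..Suc v}" and d: "defect {l..Suc v} p = 0" and av: "avoids_on l (Suc v) p"
    using p by (auto simp: shallow132_def)
  obtain j where j: "j \<in> {l..Suc v}" "p j = Suc v" using preimage_in_interval[OF perm, of "Suc v"] lv by auto
  have j': "l < j" "j < v" using j p lv by (auto simp: le_less less_Suc_eq)
  obtain m where m: "m \<in> {l..Suc v}" "p m = v" using preimage_in_interval[OF perm, of v] lv by auto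
  have big: "p k < p x" if "l \<le> x" "x < j" "j < k" "k \<le> Suc v" for x k
    using avoids_on_max[OF perm av j(2) _ that(1-4)] j by simp
  have pl: "p v < p l" "p l < v" "l < p v"
    using big[of l v] j' permutes_less_max[OF perm j(2), of l] * permutes_greater_min[OF perm p(2), of v]
    by auto
  have mj: "l < m" "m < j"
  proof -
    show "m < j"
    proof (rule ccontr)
      assume "\<not> m < j"
      moreover have "m \<noteq> j" using m j by auto
      ultimately have "p m < p l" using big[of l m] m j' by simp
      then show False using m pl by simp
    qed
    have "m \<noteq> l" using m * by auto
    then show "l < m" using m by simp
  qed
  define r where "r = p \<circ> transpose j (Suc v)"
  have r1: "r permutes {l..Suc v}"
    unfolding r_def using perm j' by (intro permutes_compose permutes_swap_id) auto
  have rv: "r (Suc v) = Suc v" "r j = l" using p j by (auto simp: r_def)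
  have rx: "r x = p x" if "x < j" for x using that j' by (auto simp: r_def transpose_def)
  have r2: "r permutes {l..v}" using permutes_Suc_fixed(1)[OF r1 rv(1) lv] .
  have "defect {l..v} r = 0"
    using defect_zero_right[OF perm _ _ j(2)] j' d permutes_Suc_fixed(2)[OF r1 rv(1) lv]
    by (simp add: r_def[symmetric])
  moreover have "{x. l < x \<and> x < j \<and> r x < r l} = {x. l < x \<and> x < j \<and> p x < p l}"
    using rx j' by auto
  ultimately have c: "int (card {x. l < x \<and> x < j \<and> p x < p l}) = int (min (p l) j) - int l - 1"
    using defect_zero_left[OF r2 j'(1) _ rv(2)] j' rx by simp
  let ?Z = "{x. l < x \<and> x < j \<and> p x < p l}"
  have "card ?Z \<le> card ({l<..<j} - {m})" by (rule card_mono) (use pl m in auto)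
  then have 1: "card ?Z \<le> j - Suc l - 1" using mj by simp
  have "p ` ?Z \<subseteq> {l<..<p l} - {p v}"
    using permutes_greater_min[OF perm p(2)] j' inj_eq[OF permutes_inj[OF perm]] by auto
  then have "card ?Z \<le> card ({l<..<p l} - {p v})"
    using card_inj_on_le[of p ?Z] permutes_inj_on[OF perm] by auto
  then have "card ?Z \<le> p l - Suc l - 1" using pl by simp
  with 1 c mj pl show False by (auto simp: min_def split: if_splits)
qed

lemma shallow132_first_min_end:
  assumes p: "p permutes {l..Suc v}" "p l = v" "p (Suc v) = l" "p v \<noteq> Suc v" and lv: "l < v"
  defines "s \<equiv> transpose l v \<circ> transpose l (Suc v) \<circ> p"
  shows "s permutes {Suc l..v}" and "s v \<noteq> v"
    and "p \<in> shallow132 l (Suc v) \<longleftrightarrow> s \<in> shallow132 (Suc l) v"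
    and "card (descents_on l (Suc v) p) = card (descents_on (Suc l) v s) + (if s (Suc l) = v then 1 else 2)"
proof -
  have inj: "p x = p y \<longleftrightarrow> x = y" for x y using permutes_inj[OF p(1)] by (rule inj_eq)
  obtain j where j: "j \<in> {l..Suc v}" "p j = Suc v" using preimage_in_interval[OF p(1), of "Suc v"] lv by auto
  have j': "l < j" "j < v"
  proof -
    have "j \<noteq> l" "j \<noteq> Suc v" "j \<noteq> v" using j p lv by auto
    then show "l < j" "j < v" using j by auto
  qed
  define r where "r = p \<circ> transpose j (Suc v)"
  have r1: "r permutes {l..Suc v}"
    unfolding r_def using p j' by (intro permutes_compose permutes_swap_id) auto
  have rv: "r (Suc v) = Suc v" "r j = l" using p j by (auto simp: r_def)
  have rx: "r x = p x" if "x < j" for x using that j' by (auto simp: r_def transpose_def)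
  have r2: "r permutes {l..v}" using permutes_Suc_fixed(1)[OF r1 rv(1)] lv by simp
  \<comment> \<open>Both exchanges of positions involve \<open>j\<close>, which depends on
    \<open>p\<close>. Rewritten as exchanges of values they become one fixed map, invertible for all
    \<open>p\<close> at once.\<close>
  have "r = transpose l (Suc v) \<circ> p"
    unfolding r_def comp_transpose[OF permutes_inj[OF p(1)]] using p(3) j by (simp add: transpose_commute)
  moreover have "r \<circ> transpose l j = transpose l v \<circ> r"
    unfolding comp_transpose[OF permutes_inj[OF r1]] using rv rx[of l] j' p(2) by (simp add: transpose_commute)
  ultimately have s: "s = r \<circ> transpose l j" by (simp add: s_def comp_assoc)
  have s1: "s permutes {l..v}"
    unfolding s using r2 j' by (intro permutes_compose permutes_swap_id) auto
  have sl: "s l = l" using rv by (simp add: s)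
  have sj: "s j = v" using rx[of l] j' p(2) by (simp add: s)
  have sx: "s x = p x" if "l < x" "x \<le> v" "x \<noteq> j" for x
    using that by (auto simp: s r_def transpose_def)
  show s2: "s permutes {Suc l..v}" by (rule permutes_fixed_left[OF s1 sl])
  show "s v \<noteq> v" using sj inj_eq[OF permutes_inj[OF s1], of v j] j' by simp
  have pv: "p x < v" if "l < x" "x \<le> v" "x \<noteq> j" for x
  proof -
    have "p x \<le> v" using permutes_less_max[OF p(1) j(2), of x] that by simp
    moreover have "p x \<noteq> v" using inj[of x l] p(2) that by simp
    ultimately show ?thesis by simp
  qed
  \<comment> \<open>The last entry is the minimum, so every position strictly between
    \<open>j\<close> and \<open>Suc v\<close> counts and the slack is zero.\<close>
  have "{x. j < x \<and> x < Suc v \<and> p (Suc v) < p x} = {j<..<Suc v}"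
    using permutes_greater_min[OF p(1,3)] p(3) j' by auto
  then have "defect {l..Suc v} p = 0 \<longleftrightarrow> defect {l..Suc v} r = 0"
    using defect_zero_right[OF p(1) _ _ j(2)] j' p(3) by (simp add: r_def[symmetric])
  also have "\<dots> \<longleftrightarrow> defect {l..v} r = 0" using permutes_Suc_fixed(2)[OF r1 rv(1)] lv by simp
  also have "\<dots> \<longleftrightarrow> defect {l..v} s = 0"
  proof -
    \<comment> \<open>Since \<open>r l = v\<close> exceeds all entries strictly between
      \<open>l\<close> and \<open>j\<close>, the count on the left is full as well.\<close>
    have "r x < v" if "l < x" "x < j" for x using that pv[of x] rx[of x] j' by simp
    then have "{x. l < x \<and> x < j \<and> r x < r l} = {l<..<j}" using rx[of l] p(2) j' by auto
    then show ?thesis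
      using defect_zero_left[OF r2 j'(1) _ rv(2)] j' p(2) rx[of l] by (simp add: s[symmetric])
  qed
  also have "\<dots> \<longleftrightarrow> defect {Suc l..v} s = 0" using defect_fixed_left[OF s2] lv by simp
  finally have d: "defect {l..Suc v} p = 0 \<longleftrightarrow> defect {Suc l..v} s = 0" .
  \<comment> \<open>Replacing \<open>Suc v\<close> by \<open>v\<close> at position \<open>j\<close>
    keeps the relative order, because \<open>p\<close> takes the value \<open>v\<close> only at
    \<open>l\<close>.\<close>
  have ord: "p x < p y \<longleftrightarrow> s x < s y" if "Suc l \<le> x" "x \<le> v" "Suc l \<le> y" "y \<le> v" for x y
    using that pv[of x] pv[of y] sx[of x] sx[of y] j sj by (cases "x = j"; cases "y = j") auto
  have "avoids_on l (Suc v) p \<longleftrightarrow> avoids_on l v p"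
    using permutes_greater_min[OF p(1,3)] p(3) by (intro avoids_on_last) simp
  also have "\<dots> \<longleftrightarrow> avoids_on (Suc l) v p"
  proof (rule avoids_on_first)
    fix i k assume "l < i" "i < k" "k \<le> v" "p l < p k" "p k < p i"
    then show False using pv[of k] pv[of i] p(2) by (cases "k = j"; cases "i = j") auto
  qed
  also have "\<dots> \<longleftrightarrow> avoids_on (Suc l) v s" by (rule avoids_on_cong) (rule ord)
  finally show "p \<in> shallow132 l (Suc v) \<longleftrightarrow> s \<in> shallow132 (Suc l) v"
    using p(1) s2 d by (simp add: shallow132_def)
  have "descents_on (Suc l) v p = descents_on (Suc l) v s" by (rule descents_on_cong) (rule ord)
  \<comment> \<open>The first step of \<open>p\<close> is a descent unless the maximum comes second,
    that is, unless \<open>L\<close> is empty.\<close>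
  moreover have "p (Suc l) < p l \<longleftrightarrow> s (Suc l) \<noteq> v"
    using pv[of "Suc l"] sx[of "Suc l"] sj j p(2) lv by (cases "Suc l = j") auto
  ultimately show "card (descents_on l (Suc v) p) = card (descents_on (Suc l) v s) + (if s (Suc l) = v then 1 else 2)"
    using lv permutes_greater_min[OF p(1,3), of v] p
    by (simp add: card_descents_on_last[of l v] card_descents_on_first[of l v])
qed

subsection \<open>Inverses\<close>

text \<open>An inversion of \<open>p\<close> at positions \<open>i < j\<close> is one of the inverse
  at positions \<open>p j < p i\<close>.\<close>

lemma card_inversion_set_inv:
  assumes p: "p permutes S" and S: "finite S"
  shows "card (inversion_set S (inv p)) = card (inversion_set S p)"
proof -
  have "bij_betw (\<lambda>(i, j). (p j, p i)) (inversion_set S p) (inversion_set S (inv p))"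
    by (rule bij_betw_byWitness[where f' = "\<lambda>(i, j). (inv p j, inv p i)"])
       (auto simp: inversion_set_def permutes_inverses[OF p] permutes_in_image[OF p]
          permutes_in_image[OF permutes_inv[OF p]])
  then show ?thesis by (simp add: bij_betw_same_card)
qed

lemma defect_inv:
  assumes p: "p permutes S" and S: "finite S"
  shows "defect S (inv p) = defect S p"
proof -
  have "(\<Sum>i\<in>S. \<bar>int (inv p i) - int i\<bar>) = (\<Sum>i\<in>S. \<bar>int (inv p (p i)) - int (p i)\<bar>)"
    using sum.permute[OF p, of "\<lambda>i. \<bar>int (inv p i) - int i\<bar>"] by (simp add: o_def)
  also have "\<dots> = (\<Sum>i\<in>S. \<bar>int (p i) - int i\<bar>)"
    by (simp add: permutes_inverses[OF p] abs_minus_commute)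
  finally show ?thesis
    using card_inversion_set_inv[OF p S] orbit_of_inv[OF p S] by (simp add: defect_def)
qed

text \<open>The pattern 132 is its own inverse: an occurrence in \<open>inv p\<close> at
  \<open>i\<close>, \<open>j\<close>, \<open>k\<close> becomes one in \<open>p\<close> at
  \<open>inv p i\<close>, \<open>inv p k\<close>, \<open>inv p j\<close>.\<close>

lemma avoids_on_inv:
  assumes p: "p permutes {l..u}" and a: "avoids_on l u p"
  shows "avoids_on l u (inv p)"
  unfolding avoids_on_def
proof safe
  fix i j k assume h: "l \<le> i" "i < j" "j < k" "k \<le> u" "inv p i < inv p k" "inv p k < inv p j"
  have "l \<le> inv p i" "inv p j \<le> u"
    using permutes_in_image[OF permutes_inv[OF p], of i] permutes_in_image[OF permutes_inv[OF p], of j] h by auto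
  then show False
    using avoids_onD[OF a, of "inv p i" "inv p k" "inv p j"] h by (simp add: permutes_inverses[OF p])
qed

lemma shallow132_inv:
  assumes "p \<in> shallow132 l u" shows "inv p \<in> shallow132 l u"
  using assms permutes_inv[of p "{l..u}"] defect_inv[of p "{l..u}"] avoids_on_inv[of p l u]
  by (simp add: shallow132_def)

section \<open>Left-to-right minima and descents\<close>

definition left_minima :: "nat \<Rightarrow> nat \<Rightarrow> (nat \<Rightarrow> nat) \<Rightarrow> nat set" where
  "left_minima l u p = {i \<in> {l..u}. \<forall>x\<in>{l..u}. x < i \<longrightarrow> p i < p x}"

text \<open>Every left-to-right minimum after the first position is the bottom of a descent.
  Conversely, a smaller entry to the left of a descent bottom would form a 132 with that
  descent.\<close>

lemma card_left_minima:
  assumes a: "avoids_on l u p" and p: "p permutes {l..u}" and "l \<le> u"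
  shows "card (left_minima l u p) = Suc (card (descents_on l u p))"
proof -
  have "left_minima l u p = insert l (Suc ` descents_on l u p)" (is "?L = ?R")
  proof (rule set_eqI, rule iffI)
    fix i assume i: "i \<in> ?L"
    show "i \<in> ?R"
    proof (cases "i = l")
      case False
      then obtain m where m: "i = Suc m" "l \<le> m" using i by (cases i) (auto simp: left_minima_def)
      then have "m \<in> descents_on l u p" using i by (auto simp: left_minima_def descents_on_def)
      then show ?thesis using m by simp
    qed simp
  next
    fix i assume i: "i \<in> ?R"
    show "i \<in> ?L"
    proof (cases "i = l")
      case True then show ?thesis using assms by (auto simp: left_minima_def)
    next
      case False
      then obtain m where m: "i = Suc m" "l \<le> m" "m < u" "p (Suc m) < p m"
        using i by (auto simp: descents_on_def)
      have "p i < p x" if x: "l \<le> x" "x < i" for x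
      proof (rule ccontr)
        assume "\<not> p i < p x"
        moreover have "p i \<noteq> p x" using inj_eq[OF permutes_inj[OF p], of i x] x by simp
        moreover have "x \<noteq> m" using calculation m by auto
        ultimately show False using avoids_onD[OF a, of x m i] m x by simp
      qed
      then show ?thesis using m by (auto simp: left_minima_def)
    qed
  qed
  moreover have "l \<notin> Suc ` descents_on l u p" by (auto simp: descents_on_def)
  ultimately show ?thesis by (simp add: card_image)
qed

text \<open>Among the points \<open>(i, p i)\<close>, a left-to-right minimum is one with no other
  point to its lower left, a condition symmetric in the two coordinates.\<close>

lemma card_left_minima_inv:
  assumes p: "p permutes {l..u}"
  shows "card (left_minima l u (inv p)) = card (left_minima l u p)"
proof -
  note inv = permutes_inverses[OF p]
  have in1: "p x \<in> {l..u} \<longleftrightarrow> x \<in> {l..u}" for x by (rule permutes_in_image[OF p])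
  have in2: "inv p x \<in> {l..u} \<longleftrightarrow> x \<in> {l..u}" for x by (rule permutes_in_image[OF permutes_inv[OF p]])
  have 1: "p i \<in> left_minima l u (inv p)" if i: "i \<in> left_minima l u p" for i
  proof -
    have "i < inv p x" if "x \<in> {l..u}" "x < p i" for x
    proof (rule ccontr)
      assume "\<not> i < inv p x"
      moreover have "i \<noteq> inv p x" using that inv by auto
      ultimately have "inv p x < i" by simp
      then have "p i < p (inv p x)" using i in2[of x] that(1) unfolding left_minima_def by blast
      then show False using that inv by simp
    qed
    then show ?thesis using i in1[of i] inv by (simp add: left_minima_def)
  qed
  have 2: "inv p i \<in> left_minima l u p" if i: "i \<in> left_minima l u (inv p)" for i
  proof -
    have "i < p x" if "x \<in> {l..u}" "x < inv p i" for x
    proof (rule ccontr)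
      assume "\<not> i < p x"
      moreover have "i \<noteq> p x" using that inv by auto
      ultimately have "p x < i" by simp
      then have "inv p i < inv p (p x)" using i in1[of x] that(1) unfolding left_minima_def by blast
      then show False using that inv by simp
    qed
    then show ?thesis using i in2[of i] inv by (simp add: left_minima_def)
  qed
  have "bij_betw p (left_minima l u p) (left_minima l u (inv p))"
    by (rule bij_betw_byWitness[where f' = "inv p"]) (use 1 2 inv in auto)
  then show ?thesis by (simp add: bij_betw_same_card)
qed

lemma card_descents_on_inv:
  assumes "p \<in> shallow132 l u" "l \<le> u"
  shows "card (descents_on l u (inv p)) = card (descents_on l u p)"
proof -
  have p: "p permutes {l..u}" "avoids_on l u p" using assms by (auto simp: shallow132_def)
  show ?thesis
    using card_left_minima[OF p(2,1) assms(2)] card_left_minima_inv[OF p(1)]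
      card_left_minima[OF avoids_on_inv[OF p] permutes_inv[OF p(1)] assms(2)] by simp
qed

subsection \<open>Descent polynomials\<close>

definition descent_poly :: "nat \<Rightarrow> nat \<Rightarrow> (nat \<Rightarrow> nat) set \<Rightarrow> int poly" where
  "descent_poly l u X = (\<Sum>p\<in>X. monom 1 (card (descents_on l u p)))"

lemma coeff_descent_poly:
  assumes "finite X"
  shows "coeff (descent_poly l u X) k = int (card {p\<in>X. card (descents_on l u p) = k})"
proof -
  have "coeff (descent_poly l u X) k = (\<Sum>p\<in>X. of_bool (card (descents_on l u p) = k))"
    by (simp add: descent_poly_def coeff_sum of_bool_def)
  then show ?thesis using assms by (simp add: Int_def)
qed

lemma descent_poly_bij:
  assumes "bij_betw f X Y"
    and "\<And>p. p \<in> X \<Longrightarrow> card (descents_on l u (f p)) = card (descents_on l' u' p) + c"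
  shows "descent_poly l u Y = monom 1 c * descent_poly l' u' X"
proof -
  have "descent_poly l u Y = (\<Sum>p\<in>X. monom 1 (card (descents_on l u (f p))))"
    unfolding descent_poly_def by (rule sum.reindex_bij_betw[OF assms(1), symmetric])
  also have "\<dots> = (\<Sum>p\<in>X. monom 1 c * monom 1 (card (descents_on l' u' p)))"
    by (rule sum.cong) (simp_all add: assms(2) mult_monom add.commute)
  finally show ?thesis by (simp add: descent_poly_def sum_distrib_left)
qed

lemma descent_poly_Un:
  "finite X \<Longrightarrow> finite Y \<Longrightarrow> X \<inter> Y = {} \<Longrightarrow>
    descent_poly l u (X \<union> Y) = descent_poly l u X + descent_poly l u Y"
  unfolding descent_poly_def by (rule sum.union_disjoint)

lemma finite_shallow132 [simp]: "finite (shallow132 l u)"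
  by (rule finite_subset[OF _ finite_permutations[of "{l..u}"]]) (auto simp: shallow132_def)

section \<open>Permutations starting with the maximum or ending with the minimum\<close>

definition max_first :: "nat \<Rightarrow> nat \<Rightarrow> (nat \<Rightarrow> nat) set" where
  "max_first l u = {p \<in> shallow132 l u. p l = u}"

definition min_last :: "nat \<Rightarrow> nat \<Rightarrow> (nat \<Rightarrow> nat) set" where
  "min_last l u = {p \<in> shallow132 l u. p u = l}"

lemma finite_ends [simp]: "finite (max_first l u)" "finite (min_last l u)"
  by (simp_all add: max_first_def min_last_def)

lemma bij_betw_inv_min_last: "bij_betw inv (min_last l u) (max_first l u)"
proof (rule bij_betw_byWitness[where f' = inv])
  have perm: "p permutes {l..u}" if "p \<in> shallow132 l u" for p
    using that by (simp add: shallow132_def)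
  show "\<forall>p\<in>min_last l u. inv (inv p) = p"
    using perm permutes_inv_inv by (auto simp: min_last_def)
  show "\<forall>p\<in>max_first l u. inv (inv p) = p"
    using perm permutes_inv_inv by (auto simp: max_first_def)
  show "inv ` min_last l u \<subseteq> max_first l u"
  proof
    fix q assume "q \<in> inv ` min_last l u"
    then obtain p where p: "q = inv p" "p \<in> shallow132 l u" "p u = l" by (auto simp: min_last_def)
    then have "inv p l = u" using permutes_inverses(2)[OF perm, of p u] by simp
    then show "q \<in> max_first l u" using p shallow132_inv by (simp add: max_first_def)
  qed
  show "inv ` max_first l u \<subseteq> min_last l u"
  proof
    fix q assume "q \<in> inv ` max_first l u"
    then obtain p where p: "q = inv p" "p \<in> shallow132 l u" "p l = u" by (auto simp: max_first_def)
    then have "inv p u = l" using permutes_inverses(2)[OF perm, of p l] by simp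
    then show "q \<in> min_last l u" using p shallow132_inv by (simp add: min_last_def)
  qed
qed

lemma descent_poly_max_first:
  assumes "l \<le> u"
  shows "descent_poly l u (max_first l u) = descent_poly l u (min_last l u)"
  using descent_poly_bij[OF bij_betw_inv_min_last, where l = l and u = u and l' = l and u' = u and c = 0]
    assms card_descents_on_inv by (simp add: min_last_def monom_0 flip: one_pCons)

section \<open>The smallest intervals\<close>

lemma defect_id: "finite S \<Longrightarrow> defect S id = 0"
proof -
  assume S: "finite S"
  have "inversion_set S id = {}" by (auto simp: inversion_set_def)
  moreover have "orbit_of id ` S = (\<lambda>i. {i}) ` S" by (rule image_cong) (simp_all add: orbit_of_fixed)
  ultimately show ?thesis using S by (simp add: defect_def card_image)
qed

lemma descents_on_self [simp]: "descents_on l l p = {}"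
  by (auto simp: descents_on_def)

lemma shallow132_singleton: "shallow132 l l = {id}"
  using defect_id[of "{l}"] by (auto simp: shallow132_def avoids_on_def)

lemma min_last_pair: "min_last l (Suc l) = {transpose l (Suc l)}"
proof -
  let ?t = "transpose l (Suc l)"
  have t: "?t permutes {l..Suc l}" by (rule permutes_swap_id) auto
  have "?t \<circ> ?t = id" by simp
  then have "defect {l..Suc l} ?t = 0"
    using defect_zero_right[OF t, of l] defect_id[of "{l..Suc l}"] by simp
  moreover have "avoids_on l (Suc l) ?t" by (auto simp: avoids_on_def)
  ultimately have mem: "?t \<in> min_last l (Suc l)" using t by (simp add: min_last_def shallow132_def)
  have uniq: "p = ?t" if "p \<in> min_last l (Suc l)" for p
  proof
    fix x
    have p: "p permutes {l..Suc l}" "p (Suc l) = l"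
      using that by (simp_all add: min_last_def shallow132_def)
    have "l < p l" using permutes_greater_min[OF p, of l] by simp
    moreover have "p l \<le> Suc l" using permutes_in_image[OF p(1), of l] by simp
    ultimately have "p l = Suc l" by simp
    moreover have "p x = x" if "x \<noteq> l" "x \<noteq> Suc l"
      by (rule permutes_not_in[OF p(1)]) (use that in auto)
    ultimately show "p x = ?t x" using p(2) by (cases "x = l"; cases "x = Suc l") simp_all
  qed
  show ?thesis
  proof
    show "min_last l (Suc l) \<subseteq> {?t}" using uniq by blast
  qed (use mem in simp)
qed

lemma max_first_pair: "max_first l (Suc l) = min_last l (Suc l)"
proof -
  have "inv (transpose l (Suc l)) = transpose l (Suc l)" by (rule inv_transpose_eq)
  then show ?thesis
    using bij_betw_imp_surj_on[OF bij_betw_inv_min_last, of l "Suc l"] by (simp add: min_last_pair)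
qed

section \<open>Weighted bijections from the reductions\<close>

lemma descent_poly_both_ends:
  assumes "l < v"
  shows "descent_poly l (Suc v) (min_last l (Suc v) \<inter> max_first l (Suc v))
    = monom 1 2 * descent_poly (Suc l) v (shallow132 (Suc l) v)"
proof (rule descent_poly_bij)
  let ?f = "\<lambda>p. p \<circ> transpose l (Suc v)"
  \<comment> \<open>The exchange of the end positions is an involution and serves as both directions
    of the bijection.\<close>
  have ff: "?f (?f p) = p" for p :: "nat \<Rightarrow> nat" by (simp add: comp_assoc)
  have ends: "q permutes {l..Suc v}" "q l = l" "q (Suc v) = Suc v" "?f q permutes {l..Suc v}"
    "?f q l = Suc v" "?f q (Suc v) = l" if "q \<in> shallow132 (Suc l) v" for q
  proof -
    have q: "q permutes {Suc l..v}" using that by (simp add: shallow132_def)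
    show "q l = l" "q (Suc v) = Suc v" using permutes_not_in[OF q] by simp_all
    then show "?f q l = Suc v" "?f q (Suc v) = l" by simp_all
    show q': "q permutes {l..Suc v}" by (rule permutes_subset[OF q]) auto
    show "?f q permutes {l..Suc v}"
      using q' assms by (intro permutes_compose permutes_swap_id) auto
  qed
  note both = shallow132_both_ends[OF _ _ _ assms]
  show "bij_betw ?f (shallow132 (Suc l) v) (min_last l (Suc v) \<inter> max_first l (Suc v))"
  proof (rule bij_betw_byWitness[where f' = ?f])
    show "?f ` shallow132 (Suc l) v \<subseteq> min_last l (Suc v) \<inter> max_first l (Suc v)"
    proof
      fix p assume "p \<in> ?f ` shallow132 (Suc l) v"
      then obtain q where q: "q \<in> shallow132 (Suc l) v" "p = ?f q" by blast
      have "?f q \<in> shallow132 l (Suc v)" using both(2)[OF ends(4-6)[OF q(1)]] q(1) unfolding ff by blast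
      then show "p \<in> min_last l (Suc v) \<inter> max_first l (Suc v)"
        using ends(5,6)[OF q(1)] unfolding q(2) min_last_def max_first_def by blast
    qed
    show "?f ` (min_last l (Suc v) \<inter> max_first l (Suc v)) \<subseteq> shallow132 (Suc l) v"
      using both(2) by (auto simp: min_last_def max_first_def shallow132_def)
  qed (simp_all add: ff)
  show "card (descents_on l (Suc v) (?f q)) = card (descents_on (Suc l) v q) + 2"
    if "q \<in> shallow132 (Suc l) v" for q
    using both(3)[OF ends(4-6)[OF that]] unfolding ff .
qed

text \<open>Inserting the maximum just before the trailing minimum leaves the number of descents
  unchanged, so the weight factor is \<open>1\<close>.\<close>

lemma descent_poly_max_min_end:
  assumes "l < v"
  shows "descent_poly l (Suc v) {p \<in> min_last l (Suc v). p v = Suc v}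
    = descent_poly l v (min_last l v)"
proof -
  let ?f = "\<lambda>p. p \<circ> transpose v (Suc v)"
  have ff: "?f (?f p) = p" for p :: "nat \<Rightarrow> nat" by (simp add: comp_assoc)
  have ends: "?f q permutes {l..Suc v}" "?f q v = Suc v" "?f q (Suc v) = l" if "q \<in> min_last l v" for q
  proof -
    have q: "q permutes {l..v}" "q v = l" using that by (auto simp: shallow132_def min_last_def)
    show "?f q v = Suc v" using permutes_not_in[OF q(1)] by simp
    show "?f q (Suc v) = l" using q(2) by simp
    have "q permutes {l..Suc v}" by (rule permutes_subset[OF q(1)]) auto
    then show "?f q permutes {l..Suc v}"
      using assms by (intro permutes_compose permutes_swap_id) auto
  qed
  note both = shallow132_max_min_end[OF _ _ _ assms]
  have "bij_betw ?f (min_last l v) {p \<in> min_last l (Suc v). p v = Suc v}"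
  proof (rule bij_betw_byWitness[where f' = ?f])
    show "?f ` min_last l v \<subseteq> {p \<in> min_last l (Suc v). p v = Suc v}"
    proof
      fix p assume "p \<in> ?f ` min_last l v"
      then obtain q where q: "q \<in> min_last l v" "p = ?f q" by blast
      have "q \<in> shallow132 l v" using q(1) by (simp add: min_last_def)
      then have "?f q \<in> shallow132 l (Suc v)" using both(3)[OF ends[OF q(1)]] unfolding ff by blast
      then show "p \<in> {p \<in> min_last l (Suc v). p v = Suc v}"
        using ends(2,3)[OF q(1)] unfolding q(2) min_last_def by blast
    qed
    show "?f ` {p \<in> min_last l (Suc v). p v = Suc v} \<subseteq> min_last l v"
      using both(2,3) by (auto simp: min_last_def shallow132_def)
  qed (simp_all add: ff)
  moreover have "card (descents_on l (Suc v) (?f q)) = card (descents_on l v q) + 0"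
    if "q \<in> min_last l v" for q
    using both(4)[OF ends[OF that]] unfolding ff add_0_right .
  ultimately have "descent_poly l (Suc v) {p \<in> min_last l (Suc v). p v = Suc v}
    = monom 1 0 * descent_poly l v (min_last l v)" by (rule descent_poly_bij)
  then show ?thesis by (simp add: monom_0 flip: one_pCons)
qed

text \<open>Passes from \<open>L m R\<close> to \<open>(n-1) L n R 1\<close>: the condition
  \<open>s v \<noteq> v\<close> means that \<open>R\<close> is nonempty, and the smaller gain in
  descents occurs when \<open>L\<close> is empty.\<close>

lemma bij_betw_first_min_end:
  assumes "l < v"
  shows "bij_betw (\<lambda>s. transpose l (Suc v) \<circ> transpose l v \<circ> s) {s \<in> shallow132 (Suc l) v. s v \<noteq> v}
    {p \<in> min_last l (Suc v). p l \<noteq> Suc v \<and> p v \<noteq> Suc v}" (is ?bij)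
    and "s \<in> shallow132 (Suc l) v \<Longrightarrow> s v \<noteq> v \<Longrightarrow>
      card (descents_on l (Suc v) (transpose l (Suc v) \<circ> transpose l v \<circ> s))
        = card (descents_on (Suc l) v s) + (if s (Suc l) = v then 1 else 2)"
proof -
  let ?f = "\<lambda>s. transpose l (Suc v) \<circ> transpose l v \<circ> s"
  let ?g = "\<lambda>p. transpose l v \<circ> transpose l (Suc v) \<circ> p"
  have fg: "?f (?g p) = p" and gf: "?g (?f p) = p" for p :: "nat \<Rightarrow> nat"
    by (simp_all add: fun_eq_iff)
  note both = shallow132_first_min_end[OF _ _ _ _ assms]
  have ends: "?f s permutes {l..Suc v}" "?f s l = v" "?f s (Suc v) = l" "?f s v \<noteq> Suc v"
    if "s \<in> shallow132 (Suc l) v" "s v \<noteq> v" for s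
  proof -
    have s: "s permutes {Suc l..v}" using that by (simp add: shallow132_def)
    have fixed: "s l = l" "s (Suc v) = Suc v" using permutes_not_in[OF s] by simp_all
    show "?f s l = v" "?f s (Suc v) = l" using fixed assms by (simp_all add: transpose_def)
    have "s v \<in> {Suc l..v}" using permutes_in_image[OF s, of v] assms by simp
    then show "?f s v \<noteq> Suc v" using that(2) by (simp add: transpose_def)
    have "s permutes {l..Suc v}" by (rule permutes_subset[OF s]) auto
    then show "?f s permutes {l..Suc v}"
      using assms by (intro permutes_compose permutes_swap_id) auto
  qed
  show ?bij
  proof (rule bij_betw_byWitness[where f' = ?g])
    show "?f ` {s \<in> shallow132 (Suc l) v. s v \<noteq> v} \<subseteq> {p \<in> min_last l (Suc v). p l \<noteq> Suc v \<and> p v \<noteq> Suc v}"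
    proof
      fix p assume "p \<in> ?f ` {s \<in> shallow132 (Suc l) v. s v \<noteq> v}"
      then obtain s where s: "s \<in> shallow132 (Suc l) v" "s v \<noteq> v" "p = ?f s" by blast
      have "?f s \<in> shallow132 l (Suc v)"
        using both(3)[OF ends[OF s(1,2)]] s(1) unfolding gf by blast
      then show "p \<in> {p \<in> min_last l (Suc v). p l \<noteq> Suc v \<and> p v \<noteq> Suc v}"
        using ends(2-4)[OF s(1,2)] assms unfolding s(3) min_last_def by simp
    qed
    show "?g ` {p \<in> min_last l (Suc v). p l \<noteq> Suc v \<and> p v \<noteq> Suc v} \<subseteq> {s \<in> shallow132 (Suc l) v. s v \<noteq> v}"
    proof
      fix s assume "s \<in> ?g ` {p \<in> min_last l (Suc v). p l \<noteq> Suc v \<and> p v \<noteq> Suc v}"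
      then obtain p where p: "p \<in> shallow132 l (Suc v)" "p (Suc v) = l" "p l \<noteq> Suc v" "p v \<noteq> Suc v" "s = ?g p"
        unfolding min_last_def by blast
      have perm: "p permutes {l..Suc v}" using p(1) by (simp add: shallow132_def)
      \<comment> \<open>Zero defect forces the first entry to be the second largest value, so the
        reduction applies to every \<open>p\<close> of this class.\<close>
      have "p l = v" using shallow132_first_eq[OF p(1-4)] assms by simp
      from both(2,3)[OF perm this p(2,4)] show "s \<in> {s \<in> shallow132 (Suc l) v. s v \<noteq> v}"
        using p(1) unfolding p(5) by simp
    qed
  qed (simp_all only: fg gf simp_thms ball_triv)
  show "card (descents_on l (Suc v) (?f s)) = card (descents_on (Suc l) v s) + (if s (Suc l) = v then 1 else 2)"
    if "s \<in> shallow132 (Suc l) v" "s v \<noteq> v"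
    using both(4)[OF ends[OF that]] unfolding gf .
qed

text \<open>The permutations \<open>L m R\<close> with \<open>R\<close> nonempty are split by
  whether \<open>L\<close> is empty. If it is, one descent is gained; otherwise
  \<open>shallow132_cases\<close> forces the minimum to be last, and two are gained.\<close>

lemma descent_poly_first_min_end:
  assumes "Suc l < v"
  shows "descent_poly l (Suc v) {p \<in> min_last l (Suc v). p l \<noteq> Suc v \<and> p v \<noteq> Suc v}
    = monom 1 1 * descent_poly (Suc l) v (max_first (Suc l) v)
      + monom 1 2 * descent_poly (Suc l) v (min_last (Suc l) v - max_first (Suc l) v)"
proof -
  let ?f = "\<lambda>s. transpose l (Suc v) \<circ> transpose l v \<circ> s"
  let ?S = "max_first (Suc l) v" and ?G = "min_last (Suc l) v - max_first (Suc l) v"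
  have lv: "l < v" using assms by simp
  have "{s \<in> shallow132 (Suc l) v. s v \<noteq> v} = ?S \<union> ?G"
  proof -
    have "s v \<noteq> v" if "s \<in> shallow132 (Suc l) v" "s (Suc l) = v" for s
    proof -
      have "s permutes {Suc l..v}" using that(1) by (simp add: shallow132_def)
      then show ?thesis using that(2) assms inj_eq[OF permutes_inj, of s "{Suc l..v}" v "Suc l"] by simp
    qed
    moreover have "s (Suc l) = v \<or> s v = Suc l" if "s \<in> shallow132 (Suc l) v" "s v \<noteq> v" for s
      using shallow132_cases[OF that(1) assms that(2)] .
    moreover have "s v \<noteq> v" if "s v = Suc l" for s :: "nat \<Rightarrow> nat" using that assms by simp
    ultimately show ?thesis unfolding max_first_def min_last_def by blast
  qed
  note S = this
  have bij: "bij_betw ?f (?S \<union> ?G) {p \<in> min_last l (Suc v). p l \<noteq> Suc v \<and> p v \<noteq> Suc v}"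
    using bij_betw_first_min_end(1)[OF lv] unfolding S .
  have SG: "s \<in> shallow132 (Suc l) v \<and> s v \<noteq> v" if "s \<in> ?S \<union> ?G" for s
    using that unfolding S[symmetric] by blast
  have inj: "inj_on ?f (?S \<union> ?G)" by (rule bij_betw_imp_inj_on[OF bij])
  have im: "?f ` ?S \<union> ?f ` ?G = {p \<in> min_last l (Suc v). p l \<noteq> Suc v \<and> p v \<noteq> Suc v}"
    unfolding image_Un[symmetric] by (rule bij_betw_imp_surj_on[OF bij])
  have "?f ` ?S \<inter> ?f ` ?G = ?f ` (?S \<inter> ?G)"
    by (rule inj_on_image_Int[OF inj Un_upper1 Un_upper2, symmetric])
  then have "?f ` ?S \<inter> ?f ` ?G = {}" by (simp only: Diff_disjoint image_empty)
  then have "descent_poly l (Suc v) {p \<in> min_last l (Suc v). p l \<noteq> Suc v \<and> p v \<noteq> Suc v}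
    = descent_poly l (Suc v) (?f ` ?S) + descent_poly l (Suc v) (?f ` ?G)"
    unfolding im[symmetric] by (intro descent_poly_Un finite_imageI finite_ends finite_Diff)
  also have "descent_poly l (Suc v) (?f ` ?S) = monom 1 1 * descent_poly (Suc l) v ?S"
  proof (rule descent_poly_bij)
    show "bij_betw ?f ?S (?f ` ?S)" by (rule inj_on_imp_bij_betw, rule inj_on_subset[OF inj]) blast
    fix s assume s: "s \<in> ?S"
    then have "s \<in> shallow132 (Suc l) v" "s v \<noteq> v" using SG by blast+
    moreover have "s (Suc l) = v" using s by (simp add: max_first_def)
    ultimately show "card (descents_on l (Suc v) (?f s)) = card (descents_on (Suc l) v s) + 1"
      using bij_betw_first_min_end(2)[OF lv, of s] by (simp only: simp_thms if_True)
  qed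
  also have "descent_poly l (Suc v) (?f ` ?G) = monom 1 2 * descent_poly (Suc l) v ?G"
  proof (rule descent_poly_bij)
    show "bij_betw ?f ?G (?f ` ?G)" by (rule inj_on_imp_bij_betw, rule inj_on_subset[OF inj]) blast
    fix s assume s: "s \<in> ?G"
    then have "s \<in> shallow132 (Suc l) v" "s v \<noteq> v" using SG by blast+
    moreover have "s (Suc l) \<noteq> v" using s by (simp add: max_first_def min_last_def)
    ultimately show "card (descents_on l (Suc v) (?f s)) = card (descents_on (Suc l) v s) + 2"
      using bij_betw_first_min_end(2)[OF lv, of s] by (simp only: simp_thms if_False)
  qed
  finally show ?thesis .
qed

section \<open>Fibonacci polynomials\<close>

fun fib_poly :: "nat \<Rightarrow> int poly" where
  "fib_poly 0 = 1"
| "fib_poly (Suc 0) = 1"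
| "fib_poly (Suc (Suc m)) = fib_poly (Suc m) + monom 1 1 * fib_poly m"

text \<open>Pascal's rule matches the recurrence. Truncated subtraction is harmless: for
  \<open>k > m\<close> the binomial is \<open>0 choose k\<close> with \<open>k > 0\<close>.\<close>

lemma coeff_fib_poly: "coeff (fib_poly m) k = int ((m - k) choose k)"
proof (induction m arbitrary: k rule: fib_poly.induct)
  case 1
  then show ?case by (cases k) auto
next
  case 2
  then show ?case by (cases k) auto
next
  case (3 m)
  show ?case
  proof (cases k)
    case 0
    then show ?thesis using 3 by (simp add: coeff_monom_mult)
  next
    case (Suc k')
    have "coeff (fib_poly (Suc (Suc m))) k = int ((Suc m - Suc k') choose Suc k') + int ((m - k') choose k')"
      using 3 Suc by (simp add: coeff_monom_mult)
    also have "\<dots> = int ((Suc (Suc m) - Suc k') choose Suc k')"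
    proof (cases "k' \<le> m")
      case True
      then show ?thesis by (simp add: Suc_diff_le)
    next
      case False
      then show ?thesis by (cases k') auto
    qed
    finally show ?thesis using Suc by simp
  qed
qed

section \<open>Recurrences and their solution\<close>

lemma descent_poly_shallow132_Suc:
  assumes "l \<le> v"
  shows "descent_poly l (Suc v) (shallow132 l (Suc v)) = descent_poly l v (shallow132 l v)
    + descent_poly l (Suc v) (min_last l (Suc v))
    + descent_poly l (Suc v) (min_last l (Suc v) - max_first l (Suc v))"
proof -
  let ?A = "shallow132 l (Suc v)" and ?E = "min_last l (Suc v)" and ?B = "max_first l (Suc v)"
  have "?A = shallow132 l v \<union> (?E \<union> ?B)" "shallow132 l v \<inter> (?E \<union> ?B) = {}"
  proof -
    have "p \<in> shallow132 l v \<or> p \<in> ?E \<union> ?B" if "p \<in> ?A" for p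
      using shallow132_cases[OF that] shallow132_fixed_last(1)[OF assms, of p] that assms
      unfolding max_first_def min_last_def by auto
    then show "?A = shallow132 l v \<union> (?E \<union> ?B)"
      using shallow132_fixed_last(1)[OF assms] unfolding max_first_def min_last_def by blast
    have "p \<notin> ?E \<union> ?B" if "p \<in> shallow132 l v" for p
    proof -
      have "p permutes {l..Suc v}" "p (Suc v) = Suc v"
        using shallow132_fixed_last(1)[OF assms, of p] that by (simp_all add: shallow132_def)
      then have "p l \<noteq> Suc v" "p (Suc v) \<noteq> l"
        using inj_eq[OF permutes_inj, of p "{l..Suc v}" l "Suc v"] assms by auto
      then show ?thesis by (simp add: max_first_def min_last_def)
    qed
    then show "shallow132 l v \<inter> (?E \<union> ?B) = {}" by blast
  qed
  then have "descent_poly l (Suc v) ?A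
    = descent_poly l (Suc v) (shallow132 l v) + descent_poly l (Suc v) (?E \<union> ?B)"
    using descent_poly_Un[of "shallow132 l v" "?E \<union> ?B" l "Suc v"] by simp
  also have "descent_poly l (Suc v) (shallow132 l v) = descent_poly l v (shallow132 l v)"
    unfolding descent_poly_def by (rule sum.cong) (simp_all add: shallow132_fixed_last(2)[OF assms])
  \<comment> \<open>\<open>?B\<close> is kept whole because inversion gives it the same polynomial
    as \<open>?E\<close>.\<close>
  also have "?E \<union> ?B = (?E - ?B) \<union> ?B" by blast
  also have "descent_poly l (Suc v) \<dots> = descent_poly l (Suc v) (?E - ?B) + descent_poly l (Suc v) ?B"
    by (rule descent_poly_Un) auto
  finally show ?thesis using descent_poly_max_first[of l "Suc v"] assms by simp
qed

lemma descent_poly_min_last_Suc: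
  assumes "l < v"
  shows "descent_poly l (Suc v) (min_last l (Suc v))
    = descent_poly l (Suc v) (min_last l (Suc v) - max_first l (Suc v))
      + monom 1 2 * descent_poly (Suc l) v (shallow132 (Suc l) v)"
proof -
  let ?E = "min_last l (Suc v)" and ?B = "max_first l (Suc v)"
  have "?E = (?E - ?B) \<union> (?E \<inter> ?B)" by blast
  then have "descent_poly l (Suc v) ?E = descent_poly l (Suc v) ((?E - ?B) \<union> (?E \<inter> ?B))" by simp
  also have "\<dots> = descent_poly l (Suc v) (?E - ?B) + descent_poly l (Suc v) (?E \<inter> ?B)"
    by (rule descent_poly_Un) auto
  finally show ?thesis unfolding descent_poly_both_ends[OF assms] .
qed

text \<open>Without a leading maximum, the maximum stands either just before the trailing minimum,
  form \<open>L n 1\<close>, or further inside, form \<open>(n-1) L n R 1\<close>.\<close>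

lemma descent_poly_min_last_diff_Suc:
  assumes "l < v"
  shows "descent_poly l (Suc v) (min_last l (Suc v) - max_first l (Suc v))
    = descent_poly l v (min_last l v)
      + descent_poly l (Suc v) {p \<in> min_last l (Suc v). p l \<noteq> Suc v \<and> p v \<noteq> Suc v}"
proof -
  let ?X = "{p \<in> min_last l (Suc v). p v = Suc v}"
  let ?Y = "{p \<in> min_last l (Suc v). p l \<noteq> Suc v \<and> p v \<noteq> Suc v}"
  have "p l \<noteq> Suc v" if "p \<in> ?X" for p
  proof -
    have "p permutes {l..Suc v}" "p v = Suc v" using that by (simp_all add: min_last_def shallow132_def)
    then show ?thesis using inj_eq[OF permutes_inj, of p "{l..Suc v}" l v] assms by auto
  qed
  then have "min_last l (Suc v) - max_first l (Suc v) = ?X \<union> ?Y"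
    unfolding max_first_def min_last_def by blast
  moreover have "descent_poly l (Suc v) (?X \<union> ?Y) = descent_poly l (Suc v) ?X + descent_poly l (Suc v) ?Y"
    by (rule descent_poly_Un) auto
  ultimately show ?thesis unfolding descent_poly_max_min_end[OF assms] by simp
qed

text \<open>The three families feed each other's recurrences and are solved together. The value
  \<open>0\<close> at \<open>e = 0\<close> is the Fibonacci polynomial at index \<open>-1\<close>,
  obtained by running the recurrence backwards; the truncated index \<open>2 * e - 1\<close> would
  give \<open>fib_poly 0 = 1\<close> instead.\<close>

lemma descent_poly_closed_form:
  "descent_poly l (l + d) (shallow132 l (l + d)) = fib_poly (2 * d) \<and>
   (\<forall>e. d = Suc e \<longrightarrow>
     descent_poly l (l + d) (min_last l (l + d)) = monom 1 1 * fib_poly (2 * e) \<and>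
     descent_poly l (l + d) (min_last l (l + d) - max_first l (l + d))
       = (if e = 0 then 0 else monom 1 1 * fib_poly (2 * e - 1)))"
proof (induction d arbitrary: l rule: less_induct)
  case (less d)
  have x2: "(monom 1 2 :: int poly) = monom 1 1 * monom 1 1" by (simp add: mult_monom numeral_2_eq_2)
  consider "d = 0" | "d = 1" | e where "d = Suc (Suc e)" by (metis One_nat_def not0_implies_Suc)
  then show ?case
  proof cases
    case 1
    then show ?thesis by (simp add: shallow132_singleton descent_poly_def monom_0 flip: one_pCons)
  next
    case 2
    have E: "descent_poly l (Suc l) (min_last l (Suc l)) = monom 1 1"
      by (simp add: min_last_pair descent_poly_def card_descents_on_last)
    have G: "descent_poly l (Suc l) (min_last l (Suc l) - max_first l (Suc l)) = 0"
      by (simp add: max_first_pair descent_poly_def)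
    have "fib_poly 2 = 1 + monom 1 1" by (simp add: numeral_2_eq_2)
    moreover have "descent_poly l l (shallow132 l l) = 1"
      by (simp add: shallow132_singleton descent_poly_def monom_0 flip: one_pCons)
    ultimately show ?thesis using descent_poly_shallow132_Suc[of l l] E G 2 by simp
  next
    case (3 e)
    \<comment> \<open>The recurrences refer to \<open>{l..v}\<close>, of parameter
      \<open>Suc e\<close>, and to \<open>{Suc l..v}\<close>, of parameter \<open>e\<close>.\<close>
    define v where "v = l + Suc e"
    have lv: "l < v" and v: "l + d = Suc v" "v = Suc l + e" using 3 by (simp_all add: v_def)
    have A1: "descent_poly l v (shallow132 l v) = fib_poly (Suc (Suc (2 * e)))"
      and E1: "descent_poly l v (min_last l v) = monom 1 1 * fib_poly (2 * e)"
      using less.IH[of "Suc e" l] 3 by (simp_all add: v_def)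
    have A2: "descent_poly (Suc l) v (shallow132 (Suc l) v) = fib_poly (2 * e)"
      using less.IH[of e "Suc l"] 3 unfolding v(2) by simp
    let ?Y = "{p \<in> min_last l (Suc v). p l \<noteq> Suc v \<and> p v \<noteq> Suc v}"
    have Y: "descent_poly l v (min_last l v) + descent_poly l (Suc v) ?Y = monom 1 1 * fib_poly (Suc (2 * e))"
    proof (cases e)
      case 0
      \<comment> \<open>Here \<open>v = Suc l\<close>, so the only candidate is the identity, which
        fixes \<open>v\<close>.\<close>
      then have "{s \<in> shallow132 (Suc l) v. s v \<noteq> v} = {}" using v shallow132_singleton by auto
      moreover have "?Y = (\<lambda>s. transpose l (Suc v) \<circ> transpose l v \<circ> s) ` {s \<in> shallow132 (Suc l) v. s v \<noteq> v}"
        by (rule bij_betw_imp_surj_on[OF bij_betw_first_min_end(1)[OF lv], symmetric])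
      ultimately have "?Y = {}" by (simp only: image_empty)
      then have "descent_poly l (Suc v) ?Y = 0" unfolding descent_poly_def by (simp only: sum.empty)
      then show ?thesis using E1 0 by simp
    next
      case (Suc e')
      have E2: "descent_poly (Suc l) v (min_last (Suc l) v) = monom 1 1 * fib_poly (2 * e')"
        and G2: "descent_poly (Suc l) v (min_last (Suc l) v - max_first (Suc l) v)
          = (if e' = 0 then 0 else monom 1 1 * fib_poly (2 * e' - 1))"
        using less.IH[of e "Suc l"] 3 Suc unfolding v(2) by simp_all
      \<comment> \<open>With \<open>x = monom 1 1\<close> and \<open>F = fib_poly\<close>, the sum
        is \<open>x * (x * F (2 * e'))\<close> plus, for \<open>e' > 0\<close>,
        \<open>x^2 * (x * F (2 * e' - 1))\<close>, which one recurrence step collapses.\<close>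
      have "descent_poly l (Suc v) ?Y = monom 1 1 * (monom 1 1 * fib_poly (Suc (2 * e')))"
      proof (cases e')
        case 0
        then show ?thesis
          using descent_poly_first_min_end[of l v] descent_poly_max_first[of "Suc l" v] E2 G2 v Suc by simp
      next
        case (Suc e'')
        have "fib_poly (Suc (2 * e')) = fib_poly (2 * e') + monom 1 1 * fib_poly (2 * e' - 1)"
          using Suc by simp
        then show ?thesis
          using descent_poly_first_min_end[of l v] descent_poly_max_first[of "Suc l" v] E2 G2 v \<open>e = Suc e'\<close> Suc
          unfolding x2 by (simp add: algebra_simps)
      qed
      then show ?thesis using E1 Suc by (simp add: algebra_simps)
    qed
    have G: "descent_poly l (Suc v) (min_last l (Suc v) - max_first l (Suc v)) = monom 1 1 * fib_poly (Suc (2 * e))"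
      using descent_poly_min_last_diff_Suc[OF lv] Y by simp
    have E: "descent_poly l (Suc v) (min_last l (Suc v)) = monom 1 1 * fib_poly (Suc (Suc (2 * e)))"
      using descent_poly_min_last_Suc[OF lv] G A2 unfolding x2 by (simp add: algebra_simps)
    \<comment> \<open>The sum \<open>F (2e+2) + x F (2e+2) + x F (2e+1)\<close> is
      \<open>F (2e+4)\<close> by two steps of the recurrence.\<close>
    have "descent_poly l (Suc v) (shallow132 l (Suc v)) = fib_poly (Suc (Suc (Suc (Suc (2 * e)))))"
      using descent_poly_shallow132_Suc[of l v] lv A1 G E by (simp add: algebra_simps)
    then show ?thesis using G E 3 unfolding v(1) by simp
  qed
qed

section \<open>Return to the original definitions\<close>

lemma num_cycles_eq: "num_cycles n p = card (orbit_of p ` {1..n})"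
  unfolding num_cycles_def orbit_of_def ..

lemma shallow_iff_defect: "shallow n p \<longleftrightarrow> defect {1..n} p = 0"
proof -
  \<comment> \<open>There are at most \<open>n\<close> cycles, so the natural subtraction in
    \<open>transp_dist\<close> is exact.\<close>
  have "card (orbit_of p ` {1..n}) \<le> n" using card_image_le[of "{1..n}" "orbit_of p"] by simp
  then show ?thesis
    unfolding shallow_def defect_def transp_dist_def num_cycles_eq inversions_def displacement_def
      inversion_set_def by (auto simp: of_nat_diff)
qed

theorem theorem3p5:
  fixes n k :: nat
  assumes "n \<ge> 2"
  shows "card {p. p permutes {1..n} \<and> shallow n p \<and> avoids132 n p \<and> card (descents n p) = k}
         = (2 * n - 2 - k) choose k"
proof -
  \<comment> \<open>The closed form is used with \<open>l = 1\<close> and \<open>d = n - 1\<close>,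
    so the polynomial is \<open>fib_poly (2 * (n - 1))\<close>.\<close>
  have n: "1 + (n - 1) = n" using assms by simp
  have "descents n p = descents_on 1 n p" for p
    using assms by (auto simp: descents_def descents_on_def)
  then have "{p. p permutes {1..n} \<and> shallow n p \<and> avoids132 n p \<and> card (descents n p) = k}
    = {p \<in> shallow132 1 n. card (descents_on 1 n p) = k}"
    by (auto simp: shallow132_def shallow_iff_defect avoids132_def avoids_on_def)
  then have "int (card {p. p permutes {1..n} \<and> shallow n p \<and> avoids132 n p \<and> card (descents n p) = k})
    = coeff (descent_poly 1 n (shallow132 1 n)) k"
    by (simp add: coeff_descent_poly)
  also have "\<dots> = int ((2 * (n - 1) - k) choose k)"
    using descent_poly_closed_form[of 1 "n - 1"] unfolding n coeff_fib_poly[symmetric] by simp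
  finally show ?thesis by (simp add: diff_mult_distrib2)
qed

end
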